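(* Let $\delta<0$ and $z_k=\sum_{i>k}s_i(y_{i+\delta}+y_{i+\delta-1}-y_{i-1})$ for $k\ge0$. (a) If $\limsup_kr_k<1$, then $$\frac{N_n-\theta(m(n))}{\sqrt{\sum_{k=0}^{m(n)}z_kr_k/y_k}}\xrightarrow{D}N(0,1)\quad(n\to\infty).$$ (b) If $\lim_kr_k=1$ and $\lim_k(1-r_k)/(1-r_{k-1})=1$, then $$\frac{N_n-\theta(m(n))}{\sqrt{\sum_{k=0}^{m(n)}(1-r_k)^{2\delta}}}\xrightarrow{D}N(0,1)\quad(n\to\infty).$$
   Context: Let $\{X_n,n\ge1\}$ be independent, identically distributed random variables with values in $\mathbb{Z}_+=\{0,1,2,\dots\}$ such that $p_k=P[X_1=k]>0$ for every $k\in\mathbb{Z}_+$ (set $p_m=0$ for integers $m\le -1$). For $k\in\mathbb{Z}_+$ let $y_k=\sum_{i>k}p_i$, and set $y_m=1$ for integers $m\le-1$. Let $r_k=p_k/y_{k-1}$, $k\in\mathbb{Z}_+$, and $m(t)=\min\{j\in\mathbb{Z}_+: y_j<1/t\}$ for $t>0$. For the fixed integer $\delta$ define $s_k=p_{k+\delta}/y_{k-1}$ and $\theta(k)=\sum_{i=0}^k s_i$ for $k\in\mathbb{Z}_+$. Let $M_0=0$ and $M_n=\max\{X_1,\dots,X_n\}$ for $n\ge1$, and let $N_n=\sum_{k=1}^n\mathbf{1}_{\{X_k>M_{k-1}+\delta\}}$ be the number of $\delta$-records among the first $n$ observations. $N(0,\sigma^2)$ denotes the centered normal law with variance $\sigma^2$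 and $\xrightarrow{D}$ convergence in distribution. *)

theory Defs
  imports "HOL-Probability.Probability"
begin

definition pZ :: "(nat \<Rightarrow> real) \<Rightarrow> int \<Rightarrow> real" where
  "pZ p m = (if m < 0 then 0 else p (nat m))"

definition yZ :: "(nat \<Rightarrow> real) \<Rightarrow> int \<Rightarrow> real" where
  "yZ p m = (if m < 0 then 1 else (\<Sum>j. p (nat m + 1 + j)))"

definition rr :: "(nat \<Rightarrow> real) \<Rightarrow> nat \<Rightarrow> real" where
  "rr p k = p k / yZ p (int k - 1)"

definition mm :: "(nat \<Rightarrow> real) \<Rightarrow> real \<Rightarrow> nat" where
  "mm p t = (LEAST j. yZ p (int j) < 1 / t)"

definition ss :: "(nat \<Rightarrow> real) \<Rightarrow> int \<Rightarrow> nat \<Rightarrow> real" where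
  "ss p \<delta> k = pZ p (int k + \<delta>) / yZ p (int k - 1)"

definition theta :: "(nat \<Rightarrow> real) \<Rightarrow> int \<Rightarrow> nat \<Rightarrow> real" where
  "theta p \<delta> k = (\<Sum>i\<le>k. ss p \<delta> i)"

definition zz :: "(nat \<Rightarrow> real) \<Rightarrow> int \<Rightarrow> nat \<Rightarrow> real" where
  "zz p \<delta> k = (\<Sum>j. (let i = k + 1 + j in
      ss p \<delta> i * (yZ p (int i + \<delta>) + yZ p (int i + \<delta> - 1) - yZ p (int i - 1))))"

definition runmax :: "(nat \<Rightarrow> 'a \<Rightarrow> nat) \<Rightarrow> nat \<Rightarrow> 'a \<Rightarrow> nat" where
  "runmax X n \<omega> = Max (insert 0 {X k \<omega> | k. k \<in> {1..n}})"

definition nrec :: "(nat \<Rightarrow> 'a \<Rightarrow> nat) \<Rightarrow> int \<Rightarrow> nat \<Rightarrow> 'a \<Rightarrow> nat" where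
  "nrec X \<delta> n \<omega> = card {k \<in> {1..n}. int (X k \<omega>) > int (runmax X (k - 1) \<omega>) + \<delta>}"

end

theory Submission
  imports Defs
begin

text \<open>
  Let \<open>S m\<close> be the number of \<open>\<delta>\<close>-records observed before the first value
  exceeding \<open>m\<close>. The levels \<open>k \<le> m\<close> contribute independently to \<open>S m\<close>: level \<open>k\<close>
  is a record value with probability \<open>r k\<close>, and in that case it contributes a geometric
  number of \<open>\<delta>\<close>-records with success probability \<open>q k = y k / y (k + \<delta>)\<close>. This is
  proved on the level of characteristic functions, by summing the one-step recursion for
  \<open>E[z ^ N n; M n = m]\<close> over \<open>n\<close>. A Lyapunov argument then gives a central limit theorem
  for \<open>S\<close>; summation by parts identifies its mean and variance with \<open>theta\<close> and
  with the normalisations of the theorem up to negligible boundary terms.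
  Finally \<open>S a \<le> N n \<le> S b\<close> whenever \<open>a < M n \<le> b\<close>, and the maximum \<open>M n\<close> lies with
  high probability between two deterministic levels so close to \<open>m(n)\<close> that \<open>S a\<close> and \<open>S b\<close>
  satisfy the same central limit theorem as \<open>S (m(n))\<close>.
\<close>

section \<open>Characteristic functions of thinned geometric variables\<close>

text \<open>After a fixed number of observations the levels are not independent; stopping when level
  \<open>m\<close> is first exceeded makes them so, at the price of a random time change. This is
  why the ratio \<open>1 / (q m)^2 / w m\<close>, tending to 0 (\<open>lyapunov\<close>), is
  central. A visited level has mean contribution \<open>1 / q\<close>, so the condition makes each
  level negligible in the limit theorem, makes the boundary term \<open>1 / q m - 1\<close> between
  \<open>\<mu>\<close> and \<open>theta\<close> harmless, and allows the level to be shifted by a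
  fixed number of steps. The two parts of the theorem differ in how \<open>lyapunov\<close> arises
  and in how the maximum moves. In (a) \<open>q\<close> is bounded below, and multiplying
  \<open>n\<close> by a constant changes \<open>\<mu>\<close> and \<open>w\<close> by bounded
  amounts, however many levels it spans. In (b) \<open>q\<close> tends to 0, so one level can have
  an unbounded mean, but the tail drops by a factor tending to 0 at each step and the maximum stays
  within one level of m(n) with high probability. The factors are written in
  \<open>x = (1/z - 1) / q\<close> because a geometric G has E z^G = q z / (1 - (1 - q) z) = 1 / (1
  + x).\<close>

lemma one_plus_iexp_quotient_ge:
  fixes q u :: real
  assumes "0 < q" "q \<le> 1"
  shows "1 \<le> cmod (1 + (iexp u - 1) / of_real q)"
proof -
  \<comment> \<open>Times \<open>q\<close>, the quantity is a point of the unit circle minus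
    \<open>1 - q\<close>, hence at distance at least \<open>q\<close> from 0. This keeps every later
    denominator \<open>1 + x\<close> away from zero.\<close>
  have "q = 1 - cmod (of_real (1 - q))"
    using assms by (simp del: of_real_diff)
  also have "\<dots> \<le> cmod (iexp u - of_real (1 - q))"
    using norm_triangle_ineq2[of "iexp u" "of_real (1 - q)"] by simp
  also have "iexp u - of_real (1 - q) = of_real q * (1 + (iexp u - 1) / of_real q)"
    using assms by (simp add: field_simps)
  also have "cmod \<dots> = q * cmod (1 + (iexp u - 1) / of_real q)"
    using assms by (simp add: norm_mult)
  finally show ?thesis using assms by simp
qed

text \<open>The characteristic function, evaluated at \<open>-u\<close>, of the product of a Bernoulli variable
  with parameter \<open>r\<close> and an independent geometric variable on \<open>{1, 2, \<dots>}\<close> with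
  success probability \<open>q\<close>.\<close>
definition geom_char :: "real \<Rightarrow> real \<Rightarrow> real \<Rightarrow> complex" where
  "geom_char r q u = (let x = (iexp u - 1) / of_real q in 1 - of_real r * x / (1 + x))"

text \<open>The value is a convex combination of 1 and \<open>1 / (1 + x)\<close>, and the latter
  has modulus at most 1. The bound is needed to compare two products factor by factor.\<close>

lemma norm_geom_char_le_1:
  assumes "0 \<le> r" "r \<le> 1" "0 < q" "q \<le> 1"
  shows "cmod (geom_char r q u) \<le> 1"
proof -
  define x where "x = (iexp u - 1) / complex_of_real q"
  have x: "1 \<le> cmod (1 + x)"
    using one_plus_iexp_quotient_ge[OF assms(3,4)] by (simp add: x_def)
  then have "1 + x \<noteq> 0" by auto
  then have "geom_char r q u = of_real (1 - r) + of_real r / (1 + x)"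
    unfolding geom_char_def Let_def x_def[symmetric] by (simp add: field_simps)
  also have "cmod \<dots> \<le> (1 - r) + r / cmod (1 + x)"
    using assms by (intro norm_triangle_le) (simp add: norm_divide del: of_real_diff)
  also have "r / cmod (1 + x) \<le> r / 1"
    using x assms by (intro divide_left_mono) auto
  finally show ?thesis by simp
qed

text \<open>The centred factor is compared with the characteristic function of the normal law of the
  same variance. Keeping \<open>r\<close> in the error matters: summed over the levels, the errors
  are then at most a constant times the largest \<open>|u| / q\<close>, times \<open>u^2\<close> and
  the total variance.\<close>

lemma geom_char_approx:
  fixes r q u :: real
  assumes r: "0 \<le> r" "r \<le> 1" and q: "0 < q" "q \<le> 1" and u: "\<bar>u\<bar> \<le> q"
  shows "cmod (geom_char r q (-u) * iexp (- (u * (r / q))) -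
           of_real (exp (- (u\<^sup>2 * (r * (2 - q - r) / q\<^sup>2) / 2)))) \<le> 6 * (r * (\<bar>u\<bar> / q) ^ 3)"
proof -
  define a where "a = u / q"
  define U where "U = \<bar>a\<bar>"
  have U: "0 \<le> U" "U \<le> 1" using u q by (auto simp: U_def a_def)
  have u_eq: "u = q * a" using q by (simp add: a_def)
  define x where "x = (iexp (-u) - 1) / complex_of_real q"
  have x1: "1 \<le> cmod (1 + x)"
    using one_plus_iexp_quotient_ge[OF q, of "-u"] unfolding x_def .
  then have xn: "1 + x \<noteq> 0" by auto
  have ap0: "cmod (iexp y - 1) \<le> \<bar>y\<bar>" for y
    using iexp_approx1[of y 0] by simp
  have ap1: "cmod (iexp y - 1 - \<i> * y) \<le> \<bar>y\<bar>^2 / 2" for y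
    using iexp_approx1[of y 1] by (simp add: numeral_2_eq_2 algebra_simps)
  have ap2: "cmod (iexp y - 1 - \<i> * y + y\<^sup>2 / 2) \<le> \<bar>y\<bar>^3 / 6" for y
    using iexp_approx1[of y 2] by (simp add: numeral_2_eq_2 numeral_3_eq_3 algebra_simps)
  have q2: "q\<^sup>2 \<le> 1" "q ^ 2 * U ^ 3 \<le> 1 * U ^ 3"
    using q U by (simp_all add: power_le_one mult_left_le_one_le)
  have absu: "\<bar>u\<bar> = q * U" using q by (simp add: u_eq U_def abs_mult)
  have Ux: "cmod x \<le> U"
  proof -
    have "cmod x \<le> \<bar>-u\<bar> / q" unfolding x_def norm_divide using q divide_right_mono[OF ap0[of "-u"], of q] by simp
    then show ?thesis using q absu by simp
  qed
  have e2': "cmod (x + \<i> * a) \<le> U^2 / 2"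
  proof -
    have "x + \<i> * a = (iexp (-u) - 1 - \<i> * of_real (-u)) / q"
      using q by (simp add: x_def a_def field_simps)
    also have "cmod \<dots> \<le> (\<bar>-u\<bar>^2/2) / q"
      unfolding norm_divide using q divide_right_mono[OF ap1[of "-u"], of q] by simp
    also have "\<dots> = q * U^2 / 2" using q by (simp add: absu power2_eq_square)
    also have "\<dots> \<le> U^2 / 2" using q mult_right_mono[of q 1 "U^2"] by simp
    finally show ?thesis .
  qed
  have e1: "cmod (x + \<i> * a + q * a\<^sup>2 / 2) \<le> U^3 / 6"
  proof -
    have "x + \<i> * a + q * a\<^sup>2 / 2 = (iexp (-u) - 1 - \<i> * of_real (-u) + of_real ((-u)\<^sup>2) / 2) / q"
      using q by (simp add: x_def u_eq field_simps power2_eq_square)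
    also have "cmod \<dots> \<le> (\<bar>-u\<bar>^3/6) / q"
      unfolding norm_divide using q divide_right_mono[OF ap2[of "-u"], of q] by simp
    also have "\<dots> = q^2 * U^3 / 6" using q by (simp add: absu power2_eq_square power3_eq_cube)
    also have "\<dots> \<le> U^3 / 6" using q2 by simp
    finally show ?thesis .
  qed
  have e4: "cmod (x^2 + a^2) \<le> U^3"
  proof -
    have "x^2 + a^2 = (x + \<i> * a) * (x - \<i> * a)" by (simp add: algebra_simps power2_eq_square)
    also have "cmod \<dots> \<le> (U^2/2) * (2 * U)"
      unfolding norm_mult
    proof (rule mult_mono[OF e2'])
      have "cmod (x - \<i> * a) \<le> cmod x + cmod (\<i> * a)" by (rule norm_triangle_ineq4)
      also have "\<dots> \<le> 2 * U" using Ux by (simp add: norm_mult U_def)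
      finally show "cmod (x - \<i> * a) \<le> 2 * U" .
    qed auto
    finally show ?thesis by (simp add: power2_eq_square power3_eq_cube)
  qed
  have e5: "cmod (x^3 / (1 + x)) \<le> U^3"
  proof -
    have "cmod (x^3 / (1 + x)) \<le> cmod x ^ 3 / 1"
      unfolding norm_divide norm_power using x1 by (intro divide_left_mono) auto
    also have "\<dots> \<le> U^3" using Ux by (simp add: power_mono)
    finally show ?thesis .
  qed
  \<comment> \<open>\<open>P\<close> is the second-order expansion of
    \<open>geom_char r q (-u)\<close> in \<open>a\<close>: take \<open>1 - r x + r x^2\<close> with
    \<open>x\<close> near \<open>- i a - q a^2 / 2\<close> and \<open>x^2\<close> near
    \<open>- a^2\<close>.\<close>
  define b where "b = r * q * a\<^sup>2 / 2 - r * a\<^sup>2"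
  define P :: complex where "P = 1 + \<i> * (r * a) + b"
  define e where "e = iexp (- (r * a))"
  have rU: "0 \<le> r * U^n" "r * U^n \<le> 1" for n
    using r U by (auto simp: mult_le_one power_le_one)
  have aU: "a\<^sup>2 = U\<^sup>2" by (simp add: U_def)
  have b: "\<bar>b\<bar> \<le> r * U\<^sup>2"
  proof -
    have "b = - (r * U\<^sup>2) * (1 - q / 2)" by (simp add: b_def aU algebra_simps)
    then have "\<bar>b\<bar> = (r * U\<^sup>2) * (1 - q / 2)" using rU[of 2] q r by (simp add: abs_mult)
    also have "\<dots> \<le> (r * U\<^sup>2) * 1" using rU[of 2] q by (intro mult_left_mono) auto
    finally show ?thesis by simp
  qed
  have tri: "cmod (- A + B - C) \<le> cmod A + cmod B + cmod C" for A B C :: complex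
    using norm_triangle_ineq4[of "- A + B" C] norm_triangle_ineq[of "- A" B] by simp
  have E1: "cmod (geom_char r q (-u) - P) \<le> r * (U^3 / 6 + U^3 + U^3)"
  proof -
    have "geom_char r q (-u) = 1 - r * x + r * x^2 - r * x^3 / (1 + x)"
      unfolding geom_char_def Let_def x_def[symmetric] using xn
      by (simp add: divide_simps) (simp add: algebra_simps power2_eq_square power3_eq_cube)
    then have "geom_char r q (-u) - P
       = of_real r * (- (x + \<i> * a + q * a\<^sup>2 / 2) + (x^2 + a^2) - x^3 / (1 + x))"
      by (simp add: P_def b_def algebra_simps)
    also have "cmod \<dots> = r * cmod (- (x + \<i> * a + q * a\<^sup>2 / 2) + (x^2 + a^2) - x^3 / (1 + x))"
      using r by (simp add: norm_mult)
    also have "\<dots> \<le> r * (U^3/6 + U^3 + U^3)"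
      using r(1) e1 e4 e5 by (intro mult_left_mono order_trans[OF tri] add_mono) auto
    finally show ?thesis .
  qed
  have Pn: "cmod P \<le> 3"
  proof -
    have "cmod P \<le> cmod 1 + cmod (\<i> * of_real (r * a)) + cmod (of_real b)"
      unfolding P_def by (intro norm_triangle_le add_right_mono norm_triangle_ineq order_refl)
    also have "\<dots> = 1 + r * U + \<bar>b\<bar>" using r by (simp add: norm_mult U_def)
    finally show ?thesis using b rU[of 1] rU[of 2] by simp
  qed
  have e3: "cmod (e - (1 - \<i> * (r * a) - (r * a)\<^sup>2 / 2)) \<le> r * U^3 / 6"
  proof -
    have "cmod (e - (1 - \<i> * (r * a) - (r * a)\<^sup>2 / 2)) \<le> \<bar>-(r * a)\<bar>^3 / 6"
      using ap2[of "-(r*a)"] by (simp add: e_def algebra_simps)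
    also have "\<bar>-(r * a)\<bar>^3 = r^3 * U^3" using r by (simp add: abs_mult U_def power_mult_distrib)
    also have "\<dots> \<le> r * U^3"
      using r U power_decreasing[of 1 3 r] by (intro mult_right_mono) auto
    finally show ?thesis by simp
  qed
  define w where "w = u\<^sup>2 * (r * (2 - q - r) / q\<^sup>2) / 2"
  have w: "w = U\<^sup>2 * r * (2 - q - r) / 2" using q by (simp add: w_def u_eq power_mult_distrib aU)
  have w0: "0 \<le> w" using r q U by (simp add: w)
  have w1: "w \<le> r * U^2"
  proof -
    have "w = (r * U^2) * ((2 - q - r) / 2)" by (simp add: w)
    also have "\<dots> \<le> (r * U^2) * 1" using r q rU(1)[of 2] by (intro mult_left_mono) auto
    finally show ?thesis by simp
  qed
  \<comment> \<open>The terms of order at most two in the product reduce to \<open>1 - w\<close>;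
    \<open>c\<close> collects those of order three and four.\<close>
  define c where "c = - (\<i> * (r * a) * (r * a)\<^sup>2 / 2) - \<i> * (r * a) * b - b * (r * a)\<^sup>2 / 2"
  have c: "P * (1 - \<i> * (r * a) - (r * a)\<^sup>2 / 2) = (1 - of_real w) + c"
    unfolding P_def c_def w aU[symmetric] b_def
    by (simp add: algebra_simps power2_eq_square add_divide_distrib diff_divide_distrib)
  have rrU3: "r * U * (r * U\<^sup>2) \<le> r * U^3" "r * U * (r * U)^2 \<le> r * U^3" "r * U^2 * (r * U)\<^sup>2 \<le> r * U^3"
  proof -
    show 1: "r * U * (r * U\<^sup>2) \<le> r * U^3"
      using mult_right_mono[of r 1 "r * U^3"] r rU[of 3]
      by (simp add: power2_eq_square power3_eq_cube ac_simps)
    have "r * U * (r * U)^2 \<le> r * U * (r * U\<^sup>2)"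
      using r U power_decreasing[of 1 2 r] by (intro mult_left_mono) (auto simp: power_mult_distrib intro!: mult_right_mono)
    with 1 show "r * U * (r * U)^2 \<le> r * U^3" by simp
    have "r * U^2 * (r * U)\<^sup>2 = (r * U * (r * U)^2) * U" by (simp add: power2_eq_square)
    also have "\<dots> \<le> (r * U * (r * U)^2) * 1" using r U by (intro mult_left_mono) auto
    finally show "r * U^2 * (r * U)\<^sup>2 \<le> r * U^3" using \<open>r * U * (r * U)^2 \<le> r * U^3\<close> by simp
  qed
  have cb: "cmod c \<le> 2 * (r * U^3)"
  proof -
    have n1: "cmod (\<i> * (r * a) * (r * a)\<^sup>2 / 2) = r * U * (r * U)\<^sup>2 / 2"
      using r by (simp add: norm_mult norm_divide norm_power U_def abs_mult)
    have n2: "cmod (\<i> * (r * a) * b) \<le> r * U * (r * U\<^sup>2)"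
      using r b U by (simp add: norm_mult U_def abs_mult mult_left_mono)
    have n3: "cmod (b * (r * a)\<^sup>2 / 2) \<le> r * U^2 * (r * U)\<^sup>2 / 2"
      using r b by (simp add: norm_mult norm_divide norm_power U_def abs_mult mult_right_mono)
    have "cmod c \<le> cmod (\<i> * (r * a) * (r * a)\<^sup>2 / 2) + cmod (\<i> * (r * a) * b) + cmod (b * (r * a)\<^sup>2 / 2)"
      unfolding c_def
      using norm_triangle_ineq4[of "- (\<i> * (r * a) * (r * a)\<^sup>2 / 2) - \<i> * (r * a) * b" "b * (r * a)\<^sup>2 / 2"]
        norm_triangle_ineq4[of "- (\<i> * (r * a) * (r * a)\<^sup>2 / 2)" "\<i> * (r * a) * b"]
      unfolding norm_minus_cancel by linarith
    also have "\<dots> \<le> 2 * (r * U^3)"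
      using n1 n2 n3 rrU3 by linarith
    finally show ?thesis .
  qed
  have ew: "cmod (of_real (exp (- w)) - (1 - of_real w)) \<le> r * U^3 / 2"
  proof -
    have "exp (-w) \<ge> 1 - w" using exp_ge_add_one_self[of "-w"] by simp
    moreover have "exp (-w) \<le> 1 - w + w\<^sup>2 / 2"
    proof (cases "w = 0")
      case False
      then have "1 + w + w\<^sup>2/2 \<le> exp w"
        using w0 exp_lower_Taylor_quadratic[of w] by simp
      then have "exp (-w) \<le> 1 / (1 + w + w\<^sup>2/2)"
        using w0 by (simp add: exp_minus field_simps add_pos_nonneg)
      also have "\<dots> \<le> 1 - w + w\<^sup>2 / 2"
      proof -
        have "(1 - w + w\<^sup>2 / 2) * (1 + w + w\<^sup>2/2) = 1 + w^4 / 4"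
          by (simp add: algebra_simps power2_eq_square power4_eq_xxxx)
        then have "1 \<le> (1 - w + w\<^sup>2 / 2) * (1 + w + w\<^sup>2/2)" by simp
        moreover have "0 < 1 + w + w\<^sup>2/2" using w0 by (simp add: add_pos_nonneg)
        ultimately show ?thesis by (simp add: divide_le_eq)
      qed
      finally show ?thesis .
    qed simp
    ultimately have "\<bar>exp (-w) - (1 - w)\<bar> \<le> w\<^sup>2 / 2" by simp
    also have "w\<^sup>2 \<le> r * U^3"
    proof -
      have "w\<^sup>2 \<le> (r * U^2)^2" using w0 w1 by (rule power_mono[rotated])
      also have "\<dots> = (r * U * (r * U\<^sup>2)) * U" by (simp add: power2_eq_square)
      also have "\<dots> \<le> (r * U * (r * U\<^sup>2)) * 1" using r U by (intro mult_left_mono) auto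
      finally show ?thesis using rrU3 by simp
    qed
    finally have "\<bar>exp (-w) - (1 - w)\<bar> \<le> r * U^3 / 2" by simp
    moreover have "of_real (exp (- w)) - (1 - of_real w) = complex_of_real (exp (-w) - (1 - w))" by simp
    ultimately show ?thesis by (simp only: norm_of_real)
  qed
  have "geom_char r q (-u) * e - of_real (exp (- w)) =
      (geom_char r q (-u) - P) * e + P * (e - (1 - \<i> * (r * a) - (r * a)\<^sup>2 / 2)) + c
      - (of_real (exp (- w)) - (1 - of_real w))"
    using c by (simp add: algebra_simps)
  also have "cmod \<dots> \<le> cmod ((geom_char r q (-u) - P) * e) +
      cmod (P * (e - (1 - \<i> * (r * a) - (r * a)\<^sup>2 / 2))) + cmod c + cmod (of_real (exp (- w)) - (1 - of_real w))"
    by (intro norm_triangle_le_diff add_right_mono norm_triangle_le order_refl)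
  also have "\<dots> \<le> r * (U^3 / 6 + U^3 + U^3) + 3 * (r * U^3 / 6) + 2 * (r * U^3) + r * U^3 / 2"
  proof (intro add_mono cb ew)
    show "cmod ((geom_char r q (-u) - P) * e) \<le> r * (U^3 / 6 + U^3 + U^3)"
      using E1 by (simp add: norm_mult e_def)
    show "cmod (P * (e - (1 - \<i> * (r * a) - (r * a)\<^sup>2 / 2))) \<le> 3 * (r * U^3 / 6)"
      unfolding norm_mult using Pn e3 by (intro mult_mono) auto
  qed
  \<comment> \<open>The four errors add up to 31/6 times \<open>r * U^3\<close>, rounded up to
    6.\<close>
  also have "\<dots> \<le> 6 * (r * U^3)" using rU(1)[of 3] by (simp add: algebra_simps)
  finally show ?thesis
    using q by (simp add: w_def e_def U_def a_def ac_simps)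
qed

text \<open>Stolz-Cesaro in weighted form: the divergent sum of weights absorbs the finitely many
  early terms. It serves to compare \<open>w\<close> with the sum of powers in (b) and, applied to
  increments, to show that a single power is negligible against that sum.\<close>

lemma weighted_Cesaro:
  fixes f h :: "nat \<Rightarrow> real"
  assumes h: "\<And>k. 0 < h k" and f: "(\<lambda>k. f k / h k) \<longlonglongrightarrow> L"
    and H: "filterlim (\<lambda>m. \<Sum>k\<le>m. h k) at_top sequentially"
  shows "(\<lambda>m. (\<Sum>k\<le>m. f k) / (\<Sum>k\<le>m. h k)) \<longlonglongrightarrow> L"
proof (rule LIMSEQ_I)
  fix e :: real assume e: "0 < e"
  then obtain N where N: "\<And>k. k \<ge> N \<Longrightarrow> norm (f k / h k - L) < e / 2"
    using LIMSEQ_D[OF f, of "e/2"] by auto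
  define C where "C = (\<Sum>k<N. \<bar>f k - L * h k\<bar>)"
  have "eventually (\<lambda>m. 2 * C / e < (\<Sum>k\<le>m. h k)) sequentially"
    using H by (simp add: filterlim_at_top_dense)
  then obtain m0 where m0: "\<And>m. m \<ge> m0 \<Longrightarrow> 2 * C / e < (\<Sum>k\<le>m. h k)"
    by (auto simp: eventually_sequentially)
  show "\<exists>no. \<forall>n\<ge>no. norm ((\<Sum>k\<le>n. f k) / (\<Sum>k\<le>n. h k) - L) < e"
  proof (intro exI allI impI)
    fix m assume m: "m \<ge> max m0 N"
    let ?H = "\<Sum>k\<le>m. h k"
    have Hp: "0 < ?H" by (rule sum_pos) (auto simp: h)
    have split: "{..m} = {..<N} \<union> {N..m}" "{..<N} \<inter> {N..m} = {}" using m by auto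
    have "\<bar>(\<Sum>k\<le>m. f k) - L * ?H\<bar> = \<bar>\<Sum>k\<le>m. f k - L * h k\<bar>"
      by (simp add: sum_subtractf sum_distrib_left)
    also have "\<dots> \<le> (\<Sum>k\<le>m. \<bar>f k - L * h k\<bar>)" by (rule sum_abs)
    also have "\<dots> = C + (\<Sum>k\<in>{N..m}. \<bar>f k - L * h k\<bar>)"
      unfolding split(1) C_def by (rule sum.union_disjoint) (use split in auto)
    also have "(\<Sum>k\<in>{N..m}. \<bar>f k - L * h k\<bar>) \<le> (\<Sum>k\<in>{N..m}. e / 2 * h k)"
    proof (rule sum_mono)
      fix k assume "k \<in> {N..m}"
      then have "\<bar>f k / h k - L\<bar> \<le> e / 2" using N[of k] by simp
      moreover have "f k - L * h k = (f k / h k - L) * h k" using h[of k] by (simp add: field_simps)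
      ultimately show "\<bar>f k - L * h k\<bar> \<le> e / 2 * h k" using h[of k] by (simp add: abs_mult)
    qed
    also have "\<dots> \<le> (\<Sum>k\<le>m. e / 2 * h k)"
      using h e by (intro sum_mono2) (auto simp: less_imp_le)
    also have "\<dots> = e / 2 * ?H" by (simp add: sum_distrib_left)
    also have "C < e / 2 * ?H" using m0[of m] m e by (simp add: field_simps)
    finally have "\<bar>(\<Sum>k\<le>m. f k) - L * ?H\<bar> < e * ?H" by simp
    moreover have "(\<Sum>k\<le>m. f k) / ?H - L = ((\<Sum>k\<le>m. f k) - L * ?H) / ?H"
      using Hp by (simp add: field_simps)
    ultimately show "norm ((\<Sum>k\<le>m. f k) / ?H - L) < e"
      using Hp by (simp add: abs_divide pos_divide_less_eq)
  qed
qed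

section \<open>Tail weights, means and variances\<close>

locale tail_weights =
  fixes p :: "nat \<Rightarrow> real" and \<delta> :: int
  assumes p_pos: "0 < p k" and p_sums: "p sums 1" and delta_neg: "\<delta> < 0"
begin

abbreviation y :: "int \<Rightarrow> real" where "y \<equiv> yZ p"
abbreviation r :: "nat \<Rightarrow> real" where "r \<equiv> rr p"

lemma y_nat: "y (int n) = 1 - (\<Sum>k\<le>n. p k)"
proof -
  have "(\<lambda>j. p (j + Suc n)) sums (1 - (\<Sum>k<Suc n. p k))"
    using p_sums by (rule sums_split_initial_segment)
  then show ?thesis
    by (simp add: yZ_def sums_iff lessThan_Suc_atMost add.commute)
qed

lemma y_neg: "m < 0 \<Longrightarrow> y m = 1"
  by (simp add: yZ_def)

lemma pZ_eq: "pZ p m = y (m - 1) - y m"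
proof -
  consider "m < 0" | "m = 0" | "0 < m" by linarith
  then show ?thesis
  proof cases
    case 2
    then show ?thesis using y_nat[of 0] by (simp add: pZ_def y_neg)
  next
    case 3
    then obtain k where "m = int (Suc k)" by (metis gr0_implies_Suc zero_less_imp_eq_int)
    then show ?thesis using y_nat[of k] y_nat[of "Suc k"] by (simp add: pZ_def nat_add_distrib)
  qed (simp add: pZ_def y_neg)
qed

lemma pZ_nonneg: "0 \<le> pZ p m"
  by (simp add: pZ_def less_imp_le p_pos)

lemma y_antimono: "a \<le> b \<Longrightarrow> y b \<le> y a"
proof (induction b rule: int_ge_induct)
  case (step i)
  then show ?case using pZ_eq[of "i + 1"] pZ_nonneg[of "i + 1"] by simp
qed simp

lemma y_lim: "(\<lambda>n. y (int n)) \<longlonglongrightarrow> 0"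
proof -
  have "(\<lambda>n. \<Sum>k\<le>n. p k) \<longlonglongrightarrow> 1"
    using p_sums by (simp add: sums_def_le)
  then show ?thesis
    unfolding y_nat by (auto intro!: tendsto_eq_intros)
qed

lemma y_pos: "0 < y m"
proof -
  have "y (int (nat m)) > 0"
  proof -
    have "0 \<le> y (int (Suc (nat m)))"
      by (rule LIMSEQ_le_const2[OF y_lim]) (auto intro!: exI[of _ "Suc (nat m)"] y_antimono)
    also have "\<dots> < y (int (nat m))"
      using p_pos[of "Suc (nat m)"] by (simp only: y_nat) simp
    finally show ?thesis .
  qed
  also have "y (int (nat m)) \<le> y m" by (rule y_antimono) simp
  finally show ?thesis .
qed

lemma y_nonzero: "y m \<noteq> 0"
  using y_pos[of m] by simp

lemma y_le_1: "y m \<le> 1"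
proof (cases "m < 0")
  case False
  then have "y m \<le> y (-1)" by (intro y_antimono) simp
  then show ?thesis by (simp add: y_neg)
qed (simp add: y_neg)

lemma r_eq: "r k = 1 - y (int k) / y (int k - 1)"
proof -
  have "p k = y (int k - 1) - y (int k)" using pZ_eq[of "int k"] by (simp add: pZ_def)
  then show ?thesis
    using y_pos[of "int k - 1"] by (simp add: rr_def field_simps)
qed

lemma r_bounds: "0 < r k" "r k < 1"
proof -
  show "0 < r k" using y_pos p_pos[of k] by (simp add: rr_def)
  show "r k < 1" using y_pos by (simp add: r_eq)
qed

text \<open>A \<open>\<delta>\<close>-record observed while the maximum is \<open>k\<close> increases
  the maximum with probability \<open>q k\<close>.\<close>
definition q :: "nat \<Rightarrow> real" where
  "q k = y (int k) / y (int k + \<delta>)"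

lemma q_bounds: "0 < q k" "q k \<le> 1 - r k" "q k \<le> 1"
proof -
  show "0 < q k" by (simp add: q_def y_pos)
  have "y (int k) / y (int k + \<delta>) \<le> y (int k) / y (int k - 1)"
    using delta_neg by (intro divide_left_mono y_antimono mult_pos_pos y_pos less_imp_le[OF y_pos]) auto
  then show "q k \<le> 1 - r k" by (simp add: q_def r_eq)
  then show "q k \<le> 1" using r_bounds(1)[of k] by simp
qed

definition \<mu> :: "nat \<Rightarrow> real" where
  "\<mu> m = (\<Sum>k\<le>m. r k / q k)"

text \<open>Variance of a Bernoulli variable times an independent geometric one: the second moment
  is \<open>r (2 - q) / q^2\<close>, and the mean, summed over the levels in \<open>\<mu>\<close>,
  is \<open>r / q\<close>.\<close>

definition v :: "nat \<Rightarrow> real" where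
  "v k = r k * (2 - q k - r k) / (q k)\<^sup>2"

definition w :: "nat \<Rightarrow> real" where
  "w m = (\<Sum>k\<le>m. v k)"

text \<open>Since \<open>q k\<close> is at most \<open>1 - r k\<close>, the factor
  \<open>2 - q k - r k\<close> lies between 1 and 2. Together with \<open>v_le\<close>, this
  determines the variance up to a factor 2.\<close>

lemma v_ge: "r k / (q k)\<^sup>2 \<le> v k"
proof -
  have "r k * 1 \<le> r k * (2 - q k - r k)"
    using r_bounds(1)[of k] q_bounds(1,2)[of k] by (intro mult_left_mono) linarith+
  then show ?thesis unfolding v_def by (simp add: divide_right_mono)
qed

lemma v_le: "v k \<le> 2 * r k / (q k)\<^sup>2"
proof -
  have "r k * (2 - q k - r k) \<le> r k * 2"
    using r_bounds(1)[of k] q_bounds(1,2)[of k] by (intro mult_left_mono) linarith+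
  then show ?thesis unfolding v_def by (simp add: divide_right_mono)
qed

lemma v_pos: "0 < v k"
  by (rule less_le_trans[OF divide_pos_pos[OF r_bounds(1) zero_less_power[OF q_bounds(1)]] v_ge])

lemma r_le_v: "r k \<le> v k"
proof -
  have "r k * 1 \<le> r k * (1 / (q k)\<^sup>2)"
    using r_bounds(1)[of k] q_bounds(1,3)[of k] by (intro mult_left_mono) (simp_all add: power_le_one)
  then show ?thesis using v_ge[of k] by simp
qed

lemma w_pos: "0 < w m"
  unfolding w_def by (rule sum_pos) (auto simp: v_pos)

lemma w_mono: "a \<le> b \<Longrightarrow> w a \<le> w b"
  unfolding w_def by (rule sum_mono2) (auto simp: less_imp_le v_pos)

lemma \<mu>_mono: "a \<le> b \<Longrightarrow> \<mu> a \<le> \<mu> b"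
  unfolding \<mu>_def
  by (rule sum_mono2) (simp_all add: divide_nonneg_pos q_bounds(1) less_imp_le[OF r_bounds(1)])

text \<open>At each positive level \<open>r k / q k\<close> equals
  \<open>ss p \<delta> k + 1 / q k - 1 / q (k - 1)\<close>, so the difference telescopes; the final
  \<open>- 1\<close> comes from below level 0, where all tails equal 1.\<close>

lemma \<mu>_eq_theta: "\<mu> m = theta p \<delta> m + 1 / q m - 1"
proof (induction m)
  case 0
  show ?case using delta_neg y_pos[of 0]
    by (simp add: \<mu>_def theta_def ss_def pZ_def q_def r_eq y_neg field_simps)
next
  case (Suc m)
  have "r (Suc m) / q (Suc m) = ss p \<delta> (Suc m) + 1 / q (Suc m) - 1 / q m"
    using y_pos[of "int m"] y_pos[of "1 + int m"] y_pos[of "1 + int m + \<delta>"] y_pos[of "int m + \<delta>"]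
    by (simp add: r_eq q_def ss_def pZ_eq field_simps)
  with Suc show ?case by (simp add: \<mu>_def theta_def)
qed

text \<open>Third absolute moments at level \<open>k\<close> are at most of order
  \<open>r k / (q k)^3\<close>, so the Lyapunov quotient is governed by the largest
  \<open>1 / q k\<close> against \<open>sqrt (w m)\<close>. Only the last level appears because
  monotonicity of \<open>w\<close> yields the uniform version.\<close>

definition lyapunov :: bool where
  "lyapunov \<longleftrightarrow> filterlim w at_top sequentially \<and> (\<lambda>m. 1 / (q m)\<^sup>2 / w m) \<longlonglongrightarrow> 0"

lemma lyapunovD:
  assumes lyapunov
  shows "filterlim w at_top sequentially" "(\<lambda>m. 1 / (q m)\<^sup>2 / w m) \<longlonglongrightarrow> 0"
  using assms by (simp_all only: lyapunov_def)

lemma lyapunov_uniform: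
  assumes lyapunov and e: "0 < e"
  shows "\<forall>\<^sub>F m in sequentially. \<forall>k\<le>m. 1 / q k \<le> e * sqrt (w m)"
proof -
  have "\<forall>\<^sub>F m in sequentially. 1 / (q m)\<^sup>2 / w m < e\<^sup>2"
    using e by (intro order_tendstoD(2)[OF lyapunovD(2)[OF assms(1)]]) simp
  then obtain N where N: "\<And>m. m \<ge> N \<Longrightarrow> 1 / (q m)\<^sup>2 / w m < e\<^sup>2"
    by (auto simp: eventually_sequentially)
  \<comment> \<open>One constant bounds the finitely many levels up to \<open>N\<close>, and
    \<open>w\<close> outgrows it; later levels use the condition at \<open>k\<close> itself.\<close>
  define C where "C = (\<Sum>k\<le>N. 1 / q k)"
  have "\<forall>\<^sub>F m in sequentially. (C / e)\<^sup>2 \<le> w m"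
    using lyapunovD(1)[OF assms(1)] by (simp add: filterlim_at_top)
  then show ?thesis
  proof eventually_elim
    case (elim m)
    show ?case
    proof (intro allI impI)
      fix k assume k: "k \<le> m"
      show "1 / q k \<le> e * sqrt (w m)"
      proof (cases "k \<le> N")
        case True
        then have "1 / q k \<le> C"
          unfolding C_def by (intro member_le_sum) (auto simp: less_imp_le q_bounds)
        also have "C / e \<le> sqrt (w m)"
          using elim by (rule real_le_rsqrt)
        then have "C \<le> e * sqrt (w m)" using e by (simp add: field_simps)
        finally show ?thesis .
      next
        case False
        then have "(1 / q k)\<^sup>2 < e\<^sup>2 * w k"
          using N[of k] unfolding pos_divide_less_eq[OF w_pos] power_divide by simp
        also have "\<dots> \<le> e\<^sup>2 * w m" using k by (intro mult_left_mono w_mono) auto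
        also have "\<dots> = (e * sqrt (w m))\<^sup>2"
          using w_pos[of m] by (simp add: power_mult_distrib)
        finally show ?thesis
          by (rule power2_le_imp_le[OF less_imp_le]) (use e w_pos[of m] in simp)
      qed
    qed
  qed
qed

lemma mm_upper: "0 < t \<Longrightarrow> y (int (mm p t)) < 1 / t"
proof -
  assume "0 < t"
  then have "\<forall>\<^sub>F n in sequentially. y (int n) < 1 / t"
    by (intro order_tendstoD(2)[OF y_lim]) simp
  then have "\<exists>n. y (int n) < 1 / t" by (auto dest: eventually_happens)
  then show ?thesis
    unfolding mm_def by (rule LeastI_ex)
qed

lemma mm_lower: "j < mm p t \<Longrightarrow> 1 / t \<le> y (int j)"
  unfolding mm_def by (drule not_less_Least) simp

lemma mm_mono: "0 < s \<Longrightarrow> s \<le> t \<Longrightarrow> mm p s \<le> mm p t"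
proof -
  assume "0 < s" "s \<le> t"
  then have "y (int (mm p t)) < 1 / s"
    using mm_upper[of t] frac_le[of 1 1 s t] by simp
  then show ?thesis unfolding mm_def[of p s] by (rule Least_le)
qed

lemma filterlim_mm: "filterlim (mm p) at_top at_top"
  unfolding filterlim_at_top
proof
  fix J :: nat
  have "mm p t \<ge> J" if t: "t \<ge> 1 / y (int J)" for t
  proof (rule ccontr)
    assume "\<not> J \<le> mm p t"
    then have "y (int J) \<le> y (int (mm p t))" by (intro y_antimono) simp
    moreover have "0 < t" using t y_pos[of "int J"] less_le_trans[of 0 "1 / y (int J)" t] by simp
    ultimately have "y (int J) < 1 / t" using mm_upper[of t] by simp
    with t \<open>0 < t\<close> y_pos[of "int J"] show False by (simp add: field_simps)
  qed
  then show "\<forall>\<^sub>F t in at_top. J \<le> mm p t"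
    by (auto simp: eventually_at_top_linorder)
qed

text \<open>Summation by parts: \<open>zz\<close> drops by its \<open>k\<close>-th summand at step
  \<open>k\<close>, and \<open>r k / y k\<close> is the increment
  \<open>1 / y k - 1 / y (k - 1)\<close>. What remains, that summand over \<open>y (k - 1)\<close>,
  differs from \<open>v k\<close> by an increment of \<open>1 / q^2 - 1 / q\<close>.\<close>

lemma sum_zz_eq:
  assumes "summable (\<lambda>i. ss p \<delta> i * (y (int i + \<delta>) + y (int i + \<delta> - 1) - y (int i - 1)))"
  shows "(\<Sum>k\<le>m. zz p \<delta> k * r k / y (int k)) =
    w m + zz p \<delta> m / y (int m) - zz p \<delta> 0 - 1 / (q m)\<^sup>2 + 1 / q m"
proof (induction m)
  case 0
  show ?case using delta_neg y_pos[of 0]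
    by (simp add: w_def v_def q_def r_eq y_neg field_simps power2_eq_square)
next
  case (Suc m)
  define f where "f i = ss p \<delta> i * (y (int i + \<delta>) + y (int i + \<delta> - 1) - y (int i - 1))" for i
  have zz: "zz p \<delta> k = (\<Sum>j. f (j + (k + 1)))" for k
    by (simp add: zz_def f_def Let_def algebra_simps)
  have "summable (\<lambda>j. f (j + (m + 1)))"
    using assms unfolding f_def[symmetric] by (rule summable_ignore_initial_segment)
  from suminf_split_head[OF this] have zS: "zz p \<delta> m = zz p \<delta> (Suc m) + f (Suc m)"
    by (simp add: zz)
  \<comment> \<open>Here \<open>A\<close>, \<open>B\<close>, \<open>E\<close>, \<open>F\<close>
    stand for \<open>y\<close> at \<open>m + 1\<close>, \<open>m\<close>,
    \<open>m + 1 + \<delta>\<close> and \<open>m + \<delta>\<close>.\<close>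
  have alg: "(1 - A / B) * (2 - A / E - (1 - A / B)) / (A / E)\<^sup>2 =
      (F - E) / B * (E + F - B) / B + 1 / (A / E)\<^sup>2 - 1 / (B / F)\<^sup>2 - 1 / (A / E) + 1 / (B / F)"
    if "0 < A" "0 < B" "0 < E" "0 < F" for A B E F :: real
  proof -
    have "(1 - A / B) * (2 - A / E - (1 - A / B)) / (A / E)\<^sup>2 = (E/A)\<^sup>2 - (E/B)\<^sup>2 - E/A + E/B"
      using that by (simp add: field_simps power2_eq_square)
    moreover have "(F - E) / B * (E + F - B) / B = (F/B)\<^sup>2 - (E/B)\<^sup>2 - F/B + E/B"
      using that by (simp add: field_simps power2_eq_square)
    ultimately show ?thesis by (simp add: power_divide)
  qed
  have "v (Suc m) = f (Suc m) / y (int m) + 1 / (q (Suc m))\<^sup>2 - 1 / (q m)\<^sup>2 - 1 / q (Suc m) + 1 / q m"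
    using alg[OF y_pos[of "1 + int m"] y_pos[of "int m"] y_pos[of "1 + int m + \<delta>"] y_pos[of "int m + \<delta>"]]
    by (simp add: v_def r_eq q_def ss_def pZ_eq f_def)
  moreover have "zz p \<delta> (Suc m) * r (Suc m) / y (int (Suc m)) =
      zz p \<delta> (Suc m) / y (int (Suc m)) - zz p \<delta> (Suc m) / y (int m)"
    using y_pos[of "int m"] y_pos[of "1 + int m"] by (simp add: r_eq field_simps)
  ultimately show ?case using Suc zS
    by (simp add: w_def add_divide_distrib)
qed

end

section \<open>Asymptotics of the variances\<close>

context tail_weights
begin

text \<open>\<open>q k\<close> is a product of \<open>- \<delta>\<close> ratios of consecutive
  tails, equal to \<open>1 - r j\<close> at levels \<open>j\<close> from 0 on and to 1 below. The
  limsup controls all but finitely many \<open>r j\<close>, and the remaining ones are each below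
  1.\<close>

lemma q_bounded_below:
  assumes "limsup (\<lambda>k. ereal (r k)) < 1"
  obtains c where "0 < c" "\<And>k. c \<le> q k"
proof -
  obtain b where b: "limsup (\<lambda>k. ereal (r k)) < ereal b" "ereal b < 1"
    using ereal_dense2[OF assms] by auto
  have "\<forall>\<^sub>F k in sequentially. r k < b"
    using Limsup_lessD[OF b(1)] by simp
  then obtain N where N: "\<And>k. k \<ge> N \<Longrightarrow> r k < b" by (auto simp: eventually_sequentially)
  define a where "a = Min (insert (1 - b) ((\<lambda>k. 1 - r k) ` {..N}))"
  have a0: "0 < a" using b(2) r_bounds(2) by (auto simp: a_def)
  have a: "a \<le> 1 - r k" for k
  proof (cases "k \<le> N")
    case True
    then show ?thesis unfolding a_def by (intro Min_le) auto
  next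
    case False
    then have "1 - b \<le> 1 - r k" using N[of k] by simp
    moreover have "a \<le> 1 - b" unfolding a_def by (rule Min_le) auto
    ultimately show ?thesis by simp
  qed
  have a1: "a \<le> 1" using a[of 0] r_bounds(1)[of 0] by simp
  have step: "a * y (m - 1) \<le> y m" for m
  proof (cases "m < 0")
    case False
    then have "a * y (int (nat m) - 1) \<le> y (int (nat m))"
      using a[of "nat m"] y_pos[of "int (nat m) - 1"] by (simp add: r_eq pos_le_divide_eq)
    then show ?thesis using False by simp
  qed (simp add: y_neg a1)
  have steps: "a ^ j * y (m - int j) \<le> y m" for j m
  proof (induction j)
    case (Suc j)
    have "a ^ Suc j * y (m - int (Suc j)) = a ^ j * (a * y (m - int j - 1))"
      by (simp add: algebra_simps)
    also have "\<dots> \<le> a ^ j * y (m - int j)"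
      using a0 step by (intro mult_left_mono) auto
    finally show ?case using Suc by simp
  qed simp
  show ?thesis
  proof
    show "0 < a ^ nat (-\<delta>)" using a0 by simp
    show "a ^ nat (-\<delta>) \<le> q k" for k
      using steps[of "nat (-\<delta>)" "int k"] delta_neg y_pos[of "int k + \<delta>"]
      by (simp add: q_def pos_le_divide_eq)
  qed
qed

lemma one_minus_r: "1 - r k = y (int k) / y (int k - 1)"
  by (simp add: r_eq)

text \<open>\<open>1 - r k\<close> is a ratio of consecutive tails, so \<open>- ln (1 - r k)\<close>
  telescopes. Distances between levels can thus be measured by tail ratios instead of by numbers of
  levels.\<close>

lemma sum_r_le_ln:
  assumes "a \<le> b"
  shows "(\<Sum>k\<in>{a<..b}. r k) \<le> ln (y (int a) / y (int b))"
  using assms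
proof (induction b rule: dec_induct)
  case base
  then show ?case using y_pos[of "int a"] by simp
next
  case (step n)
  have "r (Suc n) \<le> - ln (1 - r (Suc n))"
    using ln_le_minus_one[of "1 - r (Suc n)"] r_bounds(2)[of "Suc n"] by simp
  also have "\<dots> = ln (y (int n)) - ln (y (int (Suc n)))"
    unfolding one_minus_r by (simp add: ln_div y_nonzero)
  finally have "r (Suc n) \<le> ln (y (int n)) - ln (y (int (Suc n)))" .
  moreover have "{a<..Suc n} = insert (Suc n) {a<..n}" using step by auto
  ultimately show ?case using step by (simp add: ln_div y_nonzero)
qed

section \<open>Case (a): \<open>q\<close> bounded away from 0\<close>

context
  fixes c assumes c: "0 < c" "\<And>k. c \<le> q k"
begin

lemma y_ge_mult: "c * y (int k - 1) \<le> y (int k)"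
proof -
  have "c \<le> y (int k) / y (int k - 1)"
    using c(2)[of k] q_bounds(2)[of k] by (simp add: one_minus_r)
  then show ?thesis using y_pos by (simp add: pos_le_divide_eq)
qed

text \<open>Source of the divergence of the variance: \<open>- ln (1 - r k)\<close> is at most
  \<open>r k / c\<close>, hence at most \<open>v k / c\<close>, and these logarithms add up to
  \<open>- ln (y m)\<close>.\<close>

lemma w_ge_ln: "- (c * ln (y (int m))) \<le> w m"
proof -
  have "- (c * ln (1 - r k)) \<le> v k" for k
  proof -
    have k: "0 < 1 - r k" "c \<le> 1 - r k"
      using r_bounds[of k] c(2)[of k] q_bounds(2)[of k] by auto
    have "- ln (1 - r k) = ln (1 / (1 - r k))" using k by (simp add: ln_div)
    also have "\<dots> \<le> 1 / (1 - r k) - 1" using k by (intro ln_le_minus_one) simp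
    also have "\<dots> = r k / (1 - r k)" using k by (simp add: field_simps)
    also have "\<dots> \<le> r k / c" using k c r_bounds(1)[of k] by (intro divide_left_mono) auto
    finally have "- (c * ln (1 - r k)) \<le> r k" using c by (simp add: field_simps)
    then show ?thesis using r_le_v[of k] by simp
  qed
  then have "(\<Sum>k\<le>m. - (c * ln (1 - r k))) \<le> w m"
    unfolding w_def by (intro sum_mono)
  moreover have "(\<Sum>k\<le>m. ln (1 - r k)) = ln (y (int m))"
  proof (induction m)
    case 0
    show ?case by (simp add: one_minus_r y_neg)
  next
    case (Suc m)
    then show ?case by (simp add: one_minus_r ln_div y_nonzero)
  qed
  ultimately show ?thesis by (simp add: sum_negf flip: sum_distrib_left)
qed

lemma filterlim_w: "filterlim w at_top sequentially"
proof (rule filterlim_at_top_mono)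
  have "filterlim (\<lambda>m. y (int m)) (at_right 0) sequentially"
    using y_lim by (simp add: filterlim_at y_pos y_nonzero)
  then have "filterlim (\<lambda>m. ln (y (int m))) at_bot sequentially"
    by (rule filterlim_compose[OF ln_at_0])
  then have "filterlim (\<lambda>m. - ln (y (int m))) at_top sequentially"
    by (simp add: filterlim_uminus_at_top)
  then show "filterlim (\<lambda>m. c * (- ln (y (int m)))) at_top sequentially"
    using c(1) by (intro filterlim_tendsto_pos_mult_at_top[OF tendsto_const])
  show "\<forall>\<^sub>F m in sequentially. c * (- ln (y (int m))) \<le> w m"
    using w_ge_ln by simp
qed

lemma inverse_q_le: "1 / q k \<le> 1 / c" "1 / (q k)\<^sup>2 \<le> 1 / c\<^sup>2"
  by (rule frac_le, use c(1) c(2)[of k] in \<open>simp_all add: power_mono\<close>)+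

lemma lyapunov_if_bounded_below: lyapunov
  unfolding lyapunov_def
proof (intro conjI filterlim_w)
  show "(\<lambda>m. 1 / (q m)\<^sup>2 / w m) \<longlonglongrightarrow> 0"
  proof (rule tendsto_sandwich[OF _ _ tendsto_const])
    show "\<forall>\<^sub>F n in sequentially. 0 \<le> 1 / (q n)\<^sup>2 / w n"
      using w_pos by (simp add: less_imp_le)
    show "\<forall>\<^sub>F n in sequentially. 1 / (q n)\<^sup>2 / w n \<le> 1 / c\<^sup>2 / w n"
      using inverse_q_le(2) w_pos by (intro always_eventually allI divide_right_mono) (auto simp: less_imp_le)
    show "(\<lambda>n. 1 / c\<^sup>2 / w n) \<longlonglongrightarrow> 0"
      by (rule tendsto_divide_0[OF tendsto_const filterlim_at_top_imp_at_infinity[OF filterlim_w]])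
  qed
qed

text \<open>The bounds involve the tail ratio alone and not \<open>b - a\<close>. Hence passing from
  \<open>n\<close> to a multiple of \<open>n\<close> changes mean and variance by bounded
  amounts.\<close>

lemma increments_le:
  assumes "a \<le> b"
  shows "\<mu> b - \<mu> a \<le> 1 / c * ln (y (int a) / y (int b))"
    and "w b - w a \<le> 2 / c\<^sup>2 * ln (y (int a) / y (int b))"
proof -
  have split: "(\<Sum>k\<le>b. f k) - (\<Sum>k\<le>a. f k) = (\<Sum>k\<in>{a<..b}. f k)" for f :: "nat \<Rightarrow> real"
  proof -
    have "{..b} = {..a} \<union> {a<..b}" "{..a} \<inter> {a<..b} = {}" using assms by auto
    then show ?thesis by (simp add: sum.union_disjoint)
  qed
  have "\<mu> b - \<mu> a = (\<Sum>k\<in>{a<..b}. r k * (1 / q k))"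
    unfolding \<mu>_def split by simp
  also have "\<dots> \<le> (\<Sum>k\<in>{a<..b}. r k * (1 / c))"
    by (intro sum_mono mult_left_mono inverse_q_le less_imp_le[OF r_bounds(1)])
  also have "\<dots> = 1 / c * (\<Sum>k\<in>{a<..b}. r k)" by (simp add: sum_distrib_left sum_divide_distrib)
  also have "\<dots> \<le> 1 / c * ln (y (int a) / y (int b))"
    using c(1) by (intro mult_left_mono sum_r_le_ln assms) auto
  finally show "\<mu> b - \<mu> a \<le> 1 / c * ln (y (int a) / y (int b))" .
  have "w b - w a = (\<Sum>k\<in>{a<..b}. v k)"
    unfolding w_def split by simp
  also have "\<dots> \<le> (\<Sum>k\<in>{a<..b}. 2 * r k * (1 / c\<^sup>2))"
  proof (rule sum_mono)
    fix k
    have "v k \<le> 2 * r k * (1 / (q k)\<^sup>2)" using v_le[of k] by simp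
    also have "\<dots> \<le> 2 * r k * (1 / c\<^sup>2)"
      using r_bounds(1)[of k] by (intro mult_left_mono inverse_q_le) auto
    finally show "v k \<le> 2 * r k * (1 / c\<^sup>2)" .
  qed
  also have "\<dots> = 2 / c\<^sup>2 * (\<Sum>k\<in>{a<..b}. r k)" by (simp add: sum_distrib_left sum_divide_distrib)
  also have "\<dots> \<le> 2 / c\<^sup>2 * ln (y (int a) / y (int b))"
    using c(1) by (intro mult_left_mono sum_r_le_ln assms) auto
  finally show "w b - w a \<le> 2 / c\<^sup>2 * ln (y (int a) / y (int b))" .
qed

text \<open>Controls the boundary term of \<open>sum_zz_eq\<close>. One factor \<open>1 / c\<close>
  bounds \<open>y (i + \<delta>) / y i\<close> in the summand at \<open>i + 1\<close>; the other
  bounds \<open>y (m + \<delta>) / y m\<close>, since the remaining weights telescope to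
  \<open>y (m + \<delta>)\<close>.\<close>

lemma zz_bounds:
  shows "summable (\<lambda>i. ss p \<delta> i * (y (int i + \<delta>) + y (int i + \<delta> - 1) - y (int i - 1)))" (is "summable ?f")
    and "0 \<le> zz p \<delta> m / y (int m)" "zz p \<delta> m / y (int m) \<le> 2 / c\<^sup>2"
proof -
  have f0: "0 \<le> ?f i" for i
  proof -
    have "y (int i - 1) \<le> y (int i + \<delta>)" using delta_neg by (intro y_antimono) simp
    then show ?thesis using y_pos[of "int i + \<delta> - 1"] y_pos[of "int i - 1"] pZ_nonneg
      by (simp add: ss_def)
  qed
  have f1: "?f (Suc i) \<le> 2 / c * pZ p (int (Suc i) + \<delta>)" for i
  proof -
    have "?f (Suc i) \<le> ss p \<delta> (Suc i) * (2 * y (int i + \<delta>))"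
    proof (rule mult_left_mono)
      show "y (int (Suc i) + \<delta>) + y (int (Suc i) + \<delta> - 1) - y (int (Suc i) - 1) \<le> 2 * y (int i + \<delta>)"
        using y_antimono[of "int i + \<delta>" "int (Suc i) + \<delta>"] y_pos[of "int i"]
        by (simp add: algebra_simps)
      show "0 \<le> ss p \<delta> (Suc i)"
        using y_pos pZ_nonneg by (simp add: ss_def less_imp_le)
    qed
    also have "\<dots> = 2 * pZ p (int (Suc i) + \<delta>) * (1 / q i)"
      using y_pos by (simp add: ss_def q_def)
    also have "\<dots> \<le> 2 * pZ p (int (Suc i) + \<delta>) * (1 / c)"
      using pZ_nonneg by (intro mult_left_mono inverse_q_le) auto
    finally show ?thesis by simp
  qed
  have tele: "(\<lambda>j. pZ p (int (Suc (j + k)) + \<delta>)) sums y (int k + \<delta>)" for k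
  proof -
    have "(\<lambda>j. y (int (nat (-\<delta>) + j) + \<delta>)) \<longlonglongrightarrow> 0"
      using y_lim delta_neg by simp
    then have "(\<lambda>n. y (int (n + nat (-\<delta>)) + \<delta>)) \<longlonglongrightarrow> 0" by (simp add: add.commute)
    then have "(\<lambda>n. y (int n + \<delta>)) \<longlonglongrightarrow> 0" by (rule LIMSEQ_offset)
    then have "(\<lambda>n. y (int (n + k) + \<delta>)) \<longlonglongrightarrow> 0" by (rule LIMSEQ_ignore_initial_segment)
    from telescope_sums'[OF this] show ?thesis by (simp add: pZ_eq algebra_simps)
  qed
  have sm: "summable (\<lambda>j. ?f (Suc (j + k)))" for k
  proof (rule summable_comparison_test'[where N = 0])
    show "summable (\<lambda>j. 2 / c * pZ p (int (Suc (j + k)) + \<delta>))"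
      using tele[of k] by (intro summable_mult) (auto simp: sums_iff)
    show "norm (?f (Suc (j + k))) \<le> 2 / c * pZ p (int (Suc (j + k)) + \<delta>)" for j
      using f0[of "Suc (j + k)"] f1[of "j + k"] by (simp del: of_nat_Suc of_nat_add)
  qed
  show "summable ?f" using sm[of 0] unfolding add_0_right by (subst (asm) summable_Suc_iff)
  have zz: "zz p \<delta> m = (\<Sum>j. ?f (Suc (j + m)))"
    by (simp add: zz_def Let_def algebra_simps)
  then have "0 \<le> zz p \<delta> m" using sm f0 by (simp only: suminf_nonneg)
  then show "0 \<le> zz p \<delta> m / y (int m)" using y_pos[of "int m"] by simp
  have "zz p \<delta> m \<le> (\<Sum>j. 2 / c * pZ p (int (Suc (j + m)) + \<delta>))"
    unfolding zz using tele[of m] by (intro suminf_le f1 sm summable_mult) (auto simp: sums_iff)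
  also have "\<dots> = 2 / c * y (int m + \<delta>)"
    using tele[of m] by (subst suminf_mult) (auto simp: sums_iff)
  also have "y (int m + \<delta>) = y (int m) * (1 / q m)" using y_pos[of "int m"] by (simp add: q_def)
  also have "\<dots> \<le> y (int m) * (1 / c)"
    using y_pos[of "int m"] by (intro mult_left_mono inverse_q_le) auto
  finally show "zz p \<delta> m / y (int m) \<le> 2 / c\<^sup>2"
    using y_pos[of "int m"] c(1) by (simp add: field_simps power2_eq_square)
qed

lemma sum_zz_over_w: "(\<lambda>m. (\<Sum>k\<le>m. zz p \<delta> k * r k / y (int k)) / w m) \<longlonglongrightarrow> 1"
proof -
  define D where "D m = zz p \<delta> m / y (int m) - zz p \<delta> 0 - 1 / (q m)\<^sup>2 + 1 / q m" for m
  define K where "K = 2 / c\<^sup>2 + \<bar>zz p \<delta> 0\<bar> + 1 / c\<^sup>2 + 1 / c"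
  have D: "\<bar>D m\<bar> \<le> K" for m
  proof -
    have "0 \<le> 1 / (q m)\<^sup>2" "0 \<le> 1 / q m" using q_bounds(1)[of m] by auto
    then show ?thesis
      using zz_bounds(2,3)[of m] inverse_q_le[of m] unfolding D_def K_def by linarith
  qed
  have "(\<lambda>m. D m / w m) \<longlonglongrightarrow> 0"
  proof (rule Lim_null_comparison)
    show "\<forall>\<^sub>F m in sequentially. norm (D m / w m) \<le> K / w m"
      using D w_pos by (intro always_eventually allI) (simp add: abs_divide divide_right_mono less_imp_le)
    show "(\<lambda>m. K / w m) \<longlonglongrightarrow> 0"
      by (rule tendsto_divide_0[OF tendsto_const filterlim_at_top_imp_at_infinity[OF filterlim_w]])
  qed
  then have "(\<lambda>m. 1 + D m / w m) \<longlonglongrightarrow> 1 + 0" by (intro tendsto_intros)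
  moreover have "(\<Sum>k\<le>m. zz p \<delta> k * r k / y (int k)) / w m = 1 + D m / w m" for m
    unfolding sum_zz_eq[OF zz_bounds(1)] D_def using w_pos[of m] by (simp add: field_simps)
  ultimately show ?thesis by simp
qed

end

text \<open>A single level adds at most \<open>2 / q^2\<close> to the variance, which
  \<open>lyapunov\<close> makes negligible; so a shift by one level preserves the scale.\<close>

lemma w_Suc_ratio: "lyapunov \<Longrightarrow> (\<lambda>m. w m / w (Suc m)) \<longlonglongrightarrow> 1"
proof -
  assume lyapunov
  then have "(\<lambda>m. 1 / (q (Suc m))\<^sup>2 / w (Suc m)) \<longlonglongrightarrow> 0"
    by (intro LIMSEQ_Suc[OF lyapunovD(2)])
  then have "(\<lambda>m. 2 * (1 / (q (Suc m))\<^sup>2 / w (Suc m))) \<longlonglongrightarrow> 2 * 0" by (intro tendsto_intros)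
  then have "(\<lambda>m. v (Suc m) / w (Suc m)) \<longlonglongrightarrow> 0"
    unfolding mult_zero_right
  proof (rule Lim_null_comparison[rotated], intro always_eventually allI)
    fix m
    have "2 * r (Suc m) / (q (Suc m))\<^sup>2 \<le> 2 * 1 / (q (Suc m))\<^sup>2"
      using r_bounds(2)[of "Suc m"] by (intro divide_right_mono) simp_all
    then have "v (Suc m) \<le> 2 * 1 / (q (Suc m))\<^sup>2"
      using v_le[of "Suc m"] by (rule order_trans[rotated])
    then have "v (Suc m) / w (Suc m) \<le> 2 * 1 / (q (Suc m))\<^sup>2 / w (Suc m)"
      by (rule divide_right_mono[OF _ less_imp_le[OF w_pos]])
    then show "norm (v (Suc m) / w (Suc m)) \<le> 2 * (1 / (q (Suc m))\<^sup>2 / w (Suc m))"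
      using v_pos[of "Suc m"] w_pos[of "Suc m"] by simp
  qed
  then have "(\<lambda>m. 1 - v (Suc m) / w (Suc m)) \<longlonglongrightarrow> 1 - 0" by (intro tendsto_intros)
  moreover have "1 - v (Suc m) / w (Suc m) = w m / w (Suc m)" for m
  proof -
    have "w (Suc m) = w m + v (Suc m)" by (simp add: w_def)
    then show ?thesis using w_pos[of "Suc m"] by (simp add: field_simps)
  qed
  ultimately show ?thesis by simp
qed

lemma inverse_q_sqrt_w: "lyapunov \<Longrightarrow> (\<lambda>m. 1 / q m / sqrt (w m)) \<longlonglongrightarrow> 0"
proof -
  assume lyapunov
  then have "(\<lambda>m. sqrt (1 / (q m)\<^sup>2 / w m)) \<longlonglongrightarrow> sqrt 0"
    by (intro tendsto_real_sqrt lyapunovD(2))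
  moreover have "sqrt (1 / (q m)\<^sup>2 / w m) = 1 / q m / sqrt (w m)" for m
    using q_bounds(1)[of m] by (simp add: real_sqrt_divide real_sqrt_mult)
  ultimately show ?thesis by simp
qed

lemma \<mu>_Suc_increment: "lyapunov \<Longrightarrow> (\<lambda>m. (\<mu> (Suc m) - \<mu> m) / sqrt (w (Suc m))) \<longlonglongrightarrow> 0"
proof -
  assume lyapunov
  from LIMSEQ_Suc[OF inverse_q_sqrt_w[OF this]]
  show ?thesis
  proof (rule Lim_null_comparison[rotated], intro always_eventually allI)
    fix m
    have "r (Suc m) / q (Suc m) \<le> 1 / q (Suc m)"
      using r_bounds(2)[of "Suc m"] q_bounds(1)[of "Suc m"] by (intro divide_right_mono) auto
    then have "r (Suc m) / q (Suc m) / sqrt (w (Suc m)) \<le> 1 / q (Suc m) / sqrt (w (Suc m))"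
      using w_pos[of "Suc m"] by (rule divide_right_mono[OF _ real_sqrt_ge_zero[OF less_imp_le]])
    then show "norm ((\<mu> (Suc m) - \<mu> m) / sqrt (w (Suc m))) \<le> 1 / q (Suc m) / sqrt (w (Suc m))"
      using r_bounds(1)[of "Suc m"] q_bounds(1)[of "Suc m"] w_pos[of "Suc m"] by (simp add: \<mu>_def)
  qed
qed

section \<open>Case (b): record probabilities tending to 1\<close>

context
  assumes r_lim: "r \<longlonglongrightarrow> 1" and r_ratio: "(\<lambda>k. (1 - r (Suc k)) / (1 - r k)) \<longlonglongrightarrow> 1"
begin

lemma one_minus_r_pos: "0 < 1 - r k"
  using r_bounds(2)[of k] by simp

text \<open>The tail quotient is a product of \<open>j\<close> factors \<open>1 - r\<close>; the
  ratio hypothesis makes neighbouring factors asymptotically equal, so all of them can be replaced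
  by the last one.\<close>

lemma y_quotient_asymp: "(\<lambda>k. y (int (k + j)) / y (int k) / (1 - r (k + j)) ^ j) \<longlonglongrightarrow> 1"
proof (induction j)
  case 0
  then show ?case using y_pos by (simp add: less_imp_neq[OF y_pos, symmetric])
next
  case (Suc j)
  have "(\<lambda>k. inverse ((1 - r (Suc k)) / (1 - r k))) \<longlonglongrightarrow> inverse 1"
    by (intro tendsto_inverse r_ratio) simp
  then have "(\<lambda>k. (1 - r k) / (1 - r (Suc k))) \<longlonglongrightarrow> 1" by simp
  from LIMSEQ_ignore_initial_segment[OF this, of j]
  have "(\<lambda>k. y (int (k + j)) / y (int k) / (1 - r (k + j)) ^ j * ((1 - r (k + j)) / (1 - r (Suc (k + j)))) ^ j)
     \<longlonglongrightarrow> 1 * 1 ^ j"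
    by (intro tendsto_mult Suc tendsto_power)
  moreover have "y (int (k + j)) / y (int k) / (1 - r (k + j)) ^ j * ((1 - r (k + j)) / (1 - r (Suc (k + j)))) ^ j
      = y (int (k + Suc j)) / y (int k) / (1 - r (k + Suc j)) ^ Suc j" for k
  proof -
    have "y (int (k + Suc j)) = (1 - r (Suc (k + j))) * y (int (k + j))"
      unfolding one_minus_r using y_pos[of "int (k + j)"] by simp
    then show ?thesis
      using one_minus_r_pos[of "k + j"] one_minus_r_pos[of "Suc (k + j)"]
      by (simp add: power_divide)
  qed
  ultimately show ?case by simp
qed

lemma q_asymp: "(\<lambda>k. q k / (1 - r k) ^ nat (-\<delta>)) \<longlonglongrightarrow> 1"
proof (rule LIMSEQ_offset[where k = "nat (-\<delta>)"])
  show "(\<lambda>k. q (k + nat (-\<delta>)) / (1 - r (k + nat (-\<delta>))) ^ nat (-\<delta>)) \<longlonglongrightarrow> 1"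
    using y_quotient_asymp[of "nat (-\<delta>)"] delta_neg by (simp add: q_def)
qed

lemma powi_eq: "(1 - r k) powi (2 * \<delta>) = 1 / ((1 - r k) ^ nat (-\<delta>))\<^sup>2"
proof -
  have "nat (- (2 * \<delta>)) = nat (-\<delta>) * 2" using delta_neg by simp
  then show ?thesis
    using delta_neg by (simp add: power_int_def power_mult inverse_eq_divide power_divide)
qed

text \<open>With \<open>q\<close> tending to 0 and \<open>r\<close> to 1, the factor
  \<open>r (2 - q - r)\<close> tends to 1. This leaves \<open>1 / q^2\<close>, and \<open>q\<close>
  is asymptotic to the power of \<open>1 - r\<close> with exponent
  \<open>- \<delta>\<close>.\<close>

lemma v_asymp: "(\<lambda>k. v k / (1 - r k) powi (2 * \<delta>)) \<longlonglongrightarrow> 1"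
proof -
  have "(\<lambda>k. 1 - r k) \<longlonglongrightarrow> 0" using r_lim by (auto intro!: tendsto_eq_intros)
  then have q0: "q \<longlonglongrightarrow> 0"
    by (rule tendsto_sandwich[OF _ _ tendsto_const, rotated 2])
      (intro always_eventually allI q_bounds(2) less_imp_le[OF q_bounds(1)])+
  have "(\<lambda>k. r k * (2 - q k - r k) / (q k / (1 - r k) ^ nat (-\<delta>))\<^sup>2) \<longlonglongrightarrow> 1 * (2 - 0 - 1) / 1\<^sup>2"
    by (intro tendsto_intros r_lim q0 q_asymp) simp
  moreover have "r k * (2 - q k - r k) / (q k / (1 - r k) ^ nat (-\<delta>))\<^sup>2 = v k / (1 - r k) powi (2 * \<delta>)" for k
    by (simp add: powi_eq v_def power_divide)
  ultimately show ?thesis by simp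
qed

lemma powi_ge_1: "1 \<le> (1 - r k) powi (2 * \<delta>)"
  using one_minus_r_pos[of k] r_bounds(1)[of k] by (simp add: powi_eq power_le_one)

lemma filterlim_sum_powi: "filterlim (\<lambda>m. \<Sum>k\<le>m. (1 - r k) powi (2 * \<delta>)) at_top sequentially"
proof (rule filterlim_at_top_mono[OF filterlim_real_sequentially], intro always_eventually allI)
  fix m
  have "real m \<le> (\<Sum>k\<le>m. 1 :: real)" by simp
  also have "\<dots> \<le> (\<Sum>k\<le>m. (1 - r k) powi (2 * \<delta>))" by (intro sum_mono powi_ge_1)
  finally show "real m \<le> (\<Sum>k\<le>m. (1 - r k) powi (2 * \<delta>))" .
qed

lemma sum_powi_over_w: "(\<lambda>m. (\<Sum>k\<le>m. (1 - r k) powi (2 * \<delta>)) / w m) \<longlonglongrightarrow> 1"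
proof -
  have "(\<lambda>m. w m / (\<Sum>k\<le>m. (1 - r k) powi (2 * \<delta>))) \<longlonglongrightarrow> 1"
    unfolding w_def
    by (intro weighted_Cesaro v_asymp filterlim_sum_powi less_le_trans[OF zero_less_one powi_ge_1])
  from tendsto_inverse[OF this] show ?thesis by simp
qed

text \<open>The last power is the sum of its own increments \<open>f\<close>. By the ratio
  hypothesis \<open>f k\<close> is negligible against \<open>h k\<close>, so the weighted Cesaro
  lemma applies with limit 0.\<close>

lemma powi_over_sum: "(\<lambda>m. (1 - r m) powi (2 * \<delta>) / (\<Sum>k\<le>m. (1 - r k) powi (2 * \<delta>))) \<longlonglongrightarrow> 0"
proof -
  define h where "h k = (1 - r k) powi (2 * \<delta>)" for k
  have h0: "0 < h k" for k using powi_ge_1[of k] by (simp add: h_def)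
  define f where "f k = (case k of 0 \<Rightarrow> h 0 | Suc j \<Rightarrow> h (Suc j) - h j)" for k
  have "(\<lambda>k. 1 - (((1 - r (Suc k)) / (1 - r k)) ^ nat (-\<delta>))\<^sup>2) \<longlonglongrightarrow> 1 - (1 ^ nat (-\<delta>))\<^sup>2"
    by (intro tendsto_intros r_ratio)
  moreover have "1 - (((1 - r (Suc k)) / (1 - r k)) ^ nat (-\<delta>))\<^sup>2 = f (Suc k) / h (Suc k)" for k
  proof -
    have "(((1 - r (Suc k)) / (1 - r k)) ^ nat (-\<delta>))\<^sup>2 = h k / h (Suc k)"
      by (simp add: h_def powi_eq power_divide)
    then show ?thesis using h0[of "Suc k"] by (simp add: f_def diff_divide_distrib)
  qed
  ultimately have "(\<lambda>k. f (Suc k) / h (Suc k)) \<longlonglongrightarrow> 0" by simp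
  then have "(\<lambda>k. f k / h k) \<longlonglongrightarrow> 0" by (rule LIMSEQ_imp_Suc)
  then have "(\<lambda>m. (\<Sum>k\<le>m. f k) / (\<Sum>k\<le>m. h k)) \<longlonglongrightarrow> 0"
    by (intro weighted_Cesaro h0) (auto simp: h_def filterlim_sum_powi)
  moreover have "(\<Sum>k\<le>m. f k) = h m" for m
    by (induction m) (simp_all add: f_def)
  ultimately show ?thesis by (simp add: h_def)
qed

lemma lyapunov_if_tendsto_1: lyapunov
  unfolding lyapunov_def
proof
  let ?H = "\<lambda>m. \<Sum>k\<le>m. (1 - r k) powi (2 * \<delta>)"
  have H: "0 < ?H m" for m
    by (rule sum_pos) (auto intro: less_le_trans[OF zero_less_one powi_ge_1])
  have 1: "(\<lambda>m. w m / ?H m) \<longlonglongrightarrow> 1"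
    using tendsto_inverse[OF sum_powi_over_w] by simp
  have "filterlim (\<lambda>m. w m / ?H m * ?H m) at_top sequentially"
    by (rule filterlim_tendsto_pos_mult_at_top[OF 1 _ filterlim_sum_powi]) simp
  moreover have "w m / ?H m * ?H m = w m" for m using H[of m] by simp
  ultimately show "filterlim w at_top sequentially" by simp
  have "(\<lambda>m. inverse ((q m / (1 - r m) ^ nat (-\<delta>))\<^sup>2) * ((1 - r m) powi (2 * \<delta>) / ?H m) * (?H m / w m)) \<longlonglongrightarrow> inverse (1\<^sup>2) * 0 * 1"
    by (intro tendsto_mult powi_over_sum sum_powi_over_w tendsto_inverse tendsto_power q_asymp) simp
  moreover have "inverse ((q m / (1 - r m) ^ nat (-\<delta>))\<^sup>2) * ((1 - r m) powi (2 * \<delta>) / ?H m) * (?H m / w m)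
      = 1 / (q m)\<^sup>2 / w m" for m
  proof -
    have "inverse ((q m / (1 - r m) ^ nat (-\<delta>))\<^sup>2) * ((1 - r m) powi (2 * \<delta>)) = 1 / (q m)\<^sup>2"
      using one_minus_r_pos[of m] by (simp add: powi_eq power_divide)
    then show ?thesis using H[of m] by (simp add: field_simps)
  qed
  ultimately show "(\<lambda>m. 1 / (q m)\<^sup>2 / w m) \<longlonglongrightarrow> 0" by simp
qed

end

end

section \<open>The running maximum and the number of records\<close>

lemma measurable_count_space_combine:
  fixes a :: "'a \<Rightarrow> 'b::countable" and b :: "'a \<Rightarrow> 'c::countable"
  assumes a: "a \<in> measurable M (count_space UNIV)" and b: "b \<in> measurable M (count_space UNIV)"
    and N: "space N = UNIV"
  shows "(\<lambda>\<omega>. g (a \<omega>) (b \<omega>)) \<in> measurable M N"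
proof (rule measurable_compose_countable[OF _ a])
  show "(\<lambda>\<omega>. g i (b \<omega>)) \<in> measurable M N" for i
    by (rule measurable_compose[OF b]) (simp add: N)
qed

lemma runmax_0: "runmax X 0 \<omega> = 0"
  by (simp add: runmax_def)

lemma runmax_Suc: "runmax X (Suc n) \<omega> = max (runmax X n \<omega>) (X (Suc n) \<omega>)"
proof -
  have "insert 0 {X k \<omega> |k. k \<in> {1..Suc n}} = insert (X (Suc n) \<omega>) (insert 0 {X k \<omega> |k. k \<in> {1..n}})"
    by (auto simp: le_Suc_eq)
  moreover have "finite {X k \<omega> |k. k \<in> {1..n}}" by (simp add: setcompr_eq_image)
  ultimately show ?thesis by (simp add: runmax_def max.commute)
qed

lemma nrec_0: "nrec X \<delta> 0 \<omega> = 0"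
  by (simp add: nrec_def)

lemma nrec_Suc:
  "nrec X \<delta> (Suc n) \<omega> = nrec X \<delta> n \<omega> + of_bool (int (runmax X n \<omega>) + \<delta> < int (X (Suc n) \<omega>))"
proof -
  let ?P = "\<lambda>k. int (runmax X (k - 1) \<omega>) + \<delta> < int (X k \<omega>)"
  have "{k \<in> {1..Suc n}. ?P k} = {k \<in> {1..n}. ?P k} \<union> (if ?P (Suc n) then {Suc n} else {})"
    by (auto simp: le_Suc_eq)
  then show ?thesis by (simp add: nrec_def)
qed

lemma nrec_mono: "m \<le> n \<Longrightarrow> nrec X \<delta> m \<omega> \<le> nrec X \<delta> n \<omega>"
  by (rule lift_Suc_mono_le) (simp_all add: nrec_Suc)

lemma runmax_le_iff: "runmax X n \<omega> \<le> m \<longleftrightarrow> (\<forall>j<n. X (Suc j) \<omega> \<le> m)"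
  by (induction n) (auto simp: runmax_0 runmax_Suc less_Suc_eq)

lemma measurable_runmax:
  assumes "\<And>i. i \<in> {1..n} \<Longrightarrow> X i \<in> measurable M (count_space UNIV)"
  shows "runmax X n \<in> measurable M (count_space UNIV)"
  using assms
proof (induction n)
  case 0
  then show ?case by (simp add: runmax_0[abs_def])
next
  case (Suc n)
  then show ?case
    unfolding runmax_Suc[abs_def] by (intro measurable_count_space_combine[where g = max]) auto
qed

lemma measurable_nrec:
  assumes "\<And>i. i \<in> {1..n} \<Longrightarrow> X i \<in> measurable M (count_space UNIV)"
  shows "nrec X \<delta> n \<in> measurable M (count_space UNIV)"
  using assms
proof (induction n)
  case 0
  then show ?case by (simp add: nrec_0[abs_def])
next
  case (Suc n)
  have "(\<lambda>\<omega>. (runmax X n \<omega>, X (Suc n) \<omega>)) \<in> measurable M (count_space UNIV)"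
    using Suc.prems by (intro measurable_count_space_combine[where g = Pair] measurable_runmax) auto
  from measurable_count_space_combine[OF Suc.IH this, of "count_space UNIV"
      "\<lambda>a b. a + of_bool (int (fst b) + \<delta> < int (snd b))"] Suc.prems
  show ?case unfolding nrec_Suc[abs_def] by simp
qed

lemma runmax_cong: "(\<And>i. i \<in> {1..n} \<Longrightarrow> X i \<omega> = Y i \<eta>) \<Longrightarrow> runmax X n \<omega> = runmax Y n \<eta>"
  by (induction n) (simp_all add: runmax_0 runmax_Suc)

lemma nrec_cong: "(\<And>i. i \<in> {1..n} \<Longrightarrow> X i \<omega> = Y i \<eta>) \<Longrightarrow> nrec X \<delta> n \<omega> = nrec Y \<delta> n \<eta>"
proof (induction n)
  case (Suc n)
  then show ?case using runmax_cong[of n X \<omega> Y \<eta>] by (simp add: nrec_Suc)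
qed (simp add: nrec_0)

locale record_model = prob_space M + tail_weights p \<delta>
  for M :: "'a measure" and p :: "nat \<Rightarrow> real" and \<delta> :: int +
  fixes X :: "nat \<Rightarrow> 'a \<Rightarrow> nat"
  assumes X_meas: "\<And>i. i \<ge> 1 \<Longrightarrow> X i \<in> measurable M (count_space UNIV)"
    and X_indep: "indep_vars (\<lambda>_. count_space UNIV) X {1..}"
    and X_dist: "\<And>i k. i \<ge> 1 \<Longrightarrow> measure M {\<omega> \<in> space M. X i \<omega> = k} = p k"
begin

lemma runmax_meas: "runmax X n \<in> measurable M (count_space UNIV)"
  by (rule measurable_runmax) (simp add: X_meas)

lemma nrec_meas: "nrec X \<delta> n \<in> measurable M (count_space UNIV)"
  by (rule measurable_nrec) (simp add: X_meas)

lemma state_meas: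
  assumes "space N = UNIV"
  shows "(\<lambda>\<omega>. f (nrec X \<delta> n \<omega>) (runmax X n \<omega>)) \<in> measurable M N"
  by (rule measurable_count_space_combine[OF nrec_meas runmax_meas assms])

text \<open>The one-step independence behind every recursion below: count and maximum after
  \<open>n\<close> steps depend on the first \<open>n\<close> observations only.\<close>

lemma expectation_mult_next:
  fixes f :: "nat \<Rightarrow> nat \<Rightarrow> 'b::{real_normed_field, banach, second_countable_topology}"
  assumes f: "\<And>i j. norm (f i j) \<le> B" and g: "\<And>i. norm (g i) \<le> C"
  shows "expectation (\<lambda>\<omega>. f (nrec X \<delta> n \<omega>) (runmax X n \<omega>) * g (X (Suc n) \<omega>)) =
    expectation (\<lambda>\<omega>. f (nrec X \<delta> n \<omega>) (runmax X n \<omega>)) * expectation (\<lambda>\<omega>. g (X (Suc n) \<omega>))"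
proof (rule indep_var_lebesgue_integral)
  let ?P = "\<lambda>A. PiM A (\<lambda>_::nat. count_space (UNIV :: nat set))"
  \<comment> \<open>The same count and maximum are evaluated on the coordinate process of the
    product space; the congruence lemmas identify the result with the original one.\<close>
  let ?F = "\<lambda>h. f (nrec (\<lambda>i h. h i) \<delta> n h) (runmax (\<lambda>i h. h i) n h)"
  have comp: "(\<lambda>h. h i) \<in> measurable (?P {1..n}) (count_space UNIV)" if "i \<in> {1..n}" for i
    using that by (rule measurable_component_singleton)
  have F: "?F \<in> borel_measurable (?P {1..n})"
    by (rule measurable_count_space_combine[where g = f, OF measurable_nrec[OF comp] measurable_runmax[OF comp]])
      (simp_all only: space_borel)
  have G: "(\<lambda>h. g (h (Suc n))) \<in> borel_measurable (?P {Suc n})"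
    by (rule measurable_compose[OF measurable_component_singleton]) auto
  have "indep_var (?P {1..n}) (\<lambda>\<omega>. restrict (\<lambda>i. X i \<omega>) {1..n}) (?P {Suc n}) (\<lambda>\<omega>. restrict (\<lambda>i. X i \<omega>) {Suc n})"
    by (rule indep_var_restrict[OF X_indep]) auto
  from indep_var_compose[OF this F G]
  have *: "indep_var borel (?F \<circ> (\<lambda>\<omega>. restrict (\<lambda>i. X i \<omega>) {1..n})) borel
      ((\<lambda>h. g (h (Suc n))) \<circ> (\<lambda>\<omega>. restrict (\<lambda>i. X i \<omega>) {Suc n}))" .
  have "?F (restrict (\<lambda>i. X i \<omega>) {1..n}) = f (nrec X \<delta> n \<omega>) (runmax X n \<omega>)" for \<omega>
    using nrec_cong[of n "\<lambda>i h. h i" "restrict (\<lambda>i. X i \<omega>) {1..n}" X \<omega> \<delta>]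
      runmax_cong[of n "\<lambda>i h. h i" "restrict (\<lambda>i. X i \<omega>) {1..n}" X \<omega>] by simp
  with * show "indep_var borel (\<lambda>\<omega>. f (nrec X \<delta> n \<omega>) (runmax X n \<omega>)) borel (\<lambda>\<omega>. g (X (Suc n) \<omega>))"
    by (simp add: comp_def)
  show "integrable M (\<lambda>\<omega>. f (nrec X \<delta> n \<omega>) (runmax X n \<omega>))"
    by (rule integrable_const_bound[where B = B]) (use f in \<open>auto intro!: state_meas\<close>)
  have "(\<lambda>\<omega>. g (X (Suc n) \<omega>)) \<in> borel_measurable M"
    by (rule measurable_compose[OF X_meas]) auto
  then show "integrable M (\<lambda>\<omega>. g (X (Suc n) \<omega>))"
    by (intro integrable_const_bound[where B = C]) (use g in auto)
qed

lemma prob_X_le: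
  assumes i: "i \<ge> 1"
  shows "prob {\<omega> \<in> space M. int (X i \<omega>) \<le> j} = 1 - y j"
proof (cases "j < 0")
  case True
  then have "{\<omega> \<in> space M. int (X i \<omega>) \<le> j} = {}" by auto
  then show ?thesis using True by (simp add: y_neg)
next
  case False
  then obtain n where n: "j = int n" by (metis nonneg_int_cases not_less)
  have "{\<omega> \<in> space M. int (X i \<omega>) \<le> j} = (\<Union>k\<le>n. {\<omega> \<in> space M. X i \<omega> = k})" by (auto simp: n)
  also have "prob \<dots> = (\<Sum>k\<le>n. prob {\<omega> \<in> space M. X i \<omega> = k})"
  proof (rule finite_measure_finite_Union)
    have "X i -` {k} \<inter> space M \<in> sets M" for k
      by (rule measurable_sets[OF X_meas[OF i]]) simp
    moreover have "X i -` {k} \<inter> space M = {\<omega> \<in> space M. X i \<omega> = k}" for k by auto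
    ultimately show "(\<lambda>k. {\<omega> \<in> space M. X i \<omega> = k}) ` {..n} \<subseteq> sets M" by auto
  qed (auto simp: disjoint_family_on_def)
  also have "\<dots> = 1 - y j" by (simp add: X_dist[OF i] n y_nat)
  finally show ?thesis .
qed

lemma sets_X:
  assumes "i \<ge> 1"
  shows "{\<omega> \<in> space M. Q (X i \<omega>)} \<in> sets M"
proof -
  have "X i -` {k. Q k} \<inter> space M \<in> sets M"
    by (rule measurable_sets[OF X_meas[OF assms]]) simp
  moreover have "X i -` {k. Q k} \<inter> space M = {\<omega> \<in> space M. Q (X i \<omega>)}" by auto
  ultimately show ?thesis by simp
qed

lemma sets_runmax: "{\<omega> \<in> space M. runmax X n \<omega> \<le> m} \<in> sets M"
proof -
  have "runmax X n -` {..m} \<inter> space M \<in> sets M" by (rule measurable_sets[OF runmax_meas]) simp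
  moreover have "runmax X n -` {..m} \<inter> space M = {\<omega> \<in> space M. runmax X n \<omega> \<le> m}" by auto
  ultimately show ?thesis by simp
qed

lemma expectation_of_bool:
  assumes "{\<omega> \<in> space M. Q \<omega>} \<in> sets M"
  shows "expectation (\<lambda>\<omega>. of_bool (Q \<omega>) :: 'b :: {real_normed_field, banach, second_countable_topology}) = of_real (prob {\<omega> \<in> space M. Q \<omega>})"
    and "integrable M (\<lambda>\<omega>. of_bool (Q \<omega>) :: 'b)"
proof -
  have eq: "of_bool (Q \<omega>) = (indicator {\<omega> \<in> space M. Q \<omega>} \<omega> *\<^sub>R 1 :: 'b)" if "\<omega> \<in> space M" for \<omega>
    using that by (simp add: indicator_def)
  have "expectation (\<lambda>\<omega>. of_bool (Q \<omega>) :: 'b) = expectation (\<lambda>\<omega>. indicator {\<omega> \<in> space M. Q \<omega>} \<omega> *\<^sub>R 1)"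
    by (rule Bochner_Integration.integral_cong) (auto simp: eq)
  also have "\<dots> = of_real (prob {\<omega> \<in> space M. Q \<omega>})"
    using assms by (subst integral_scaleR_left) (auto simp: of_real_def less_top[symmetric] Int_absorb1 sets.sets_into_space intro!: arg_cong2[where f = scaleR])
  finally show "expectation (\<lambda>\<omega>. of_bool (Q \<omega>) :: 'b) = of_real (prob {\<omega> \<in> space M. Q \<omega>})" .
  have "integrable M (\<lambda>\<omega>. indicator {\<omega> \<in> space M. Q \<omega>} \<omega> *\<^sub>R (1::'b))"
    using assms by (intro integrable_scaleR_left) (auto simp: less_top[symmetric])
  then show "integrable M (\<lambda>\<omega>. of_bool (Q \<omega>) :: 'b)"
    by (subst Bochner_Integration.integrable_cong[OF refl eq]) auto
qed

lemma prob_runmax_le: "prob {\<omega> \<in> space M. runmax X n \<omega> \<le> m} = (1 - y (int m)) ^ n"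
proof (induction n)
  case 0
  then show ?case by (simp add: runmax_0 prob_space)
next
  case (Suc n)
  have "prob {\<omega> \<in> space M. runmax X (Suc n) \<omega> \<le> m} = expectation (\<lambda>\<omega>. of_bool (runmax X (Suc n) \<omega> \<le> m))"
    using expectation_of_bool(1)[OF sets_runmax, where ?'b = real] by simp
  also have "\<dots> = expectation (\<lambda>\<omega>. of_bool (runmax X n \<omega> \<le> m) * of_bool (X (Suc n) \<omega> \<le> m))"
    by (simp add: runmax_Suc of_bool_conj)
  also have "\<dots> = expectation (\<lambda>\<omega>. of_bool (runmax X n \<omega> \<le> m)) * expectation (\<lambda>\<omega>. of_bool (X (Suc n) \<omega> \<le> m))"
    by (rule expectation_mult_next[where f = "\<lambda>_ k. of_bool (k \<le> m)" and g = "\<lambda>k. of_bool (k \<le> m)" and B = 1 and C = 1]) auto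
  also have "\<dots> = prob {\<omega> \<in> space M. runmax X n \<omega> \<le> m} * prob {\<omega> \<in> space M. int (X (Suc n) \<omega>) \<le> int m}"
    by (simp add: expectation_of_bool(1)[OF sets_runmax] expectation_of_bool(1)[OF sets_X[where Q = "\<lambda>k. k \<le> m"]])
  finally show ?case using Suc prob_X_le[of "Suc n" "int m"] by simp
qed

end

section \<open>Records before passing a level\<close>

lemma norm_of_bool: "norm (of_bool P :: 'a::real_normed_algebra_1) = of_bool P"
  by (cases P) auto

context record_model
begin

text \<open>If \<open>m\<close> is never exceeded this is a junk value, but that happens with probability 0.\<close>
definition passage :: "nat \<Rightarrow> 'a \<Rightarrow> nat" where
  "passage m \<omega> = (LEAST n. m < X (Suc n) \<omega>)"

definition S :: "nat \<Rightarrow> 'a \<Rightarrow> nat" where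
  "S m \<omega> = nrec X \<delta> (passage m \<omega>) \<omega>"

lemma passage_meas: "passage m \<in> measurable M (count_space UNIV)"
  unfolding passage_def[abs_def]
  by (intro measurable_Least measurable_compose[OF X_meas]) auto

lemma S_meas: "S m \<in> measurable M (count_space UNIV)"
  unfolding S_def[abs_def] by (rule measurable_compose_countable[OF nrec_meas passage_meas])

lemma passage_eq_iff:
  assumes "\<exists>n. m < X (Suc n) \<omega>"
  shows "passage m \<omega> = n \<longleftrightarrow> runmax X n \<omega> \<le> m \<and> m < X (Suc n) \<omega>"
proof
  assume n: "passage m \<omega> = n"
  have "m < X (Suc n) \<omega>"
    using LeastI_ex[OF assms] unfolding n[symmetric] passage_def .
  moreover have "X (Suc j) \<omega> \<le> m" if "j < n" for j
    using that unfolding n[symmetric] passage_def by (drule_tac not_less_Least) simp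
  ultimately show "runmax X n \<omega> \<le> m \<and> m < X (Suc n) \<omega>"
    by (simp add: runmax_le_iff)
next
  assume n: "runmax X n \<omega> \<le> m \<and> m < X (Suc n) \<omega>"
  show "passage m \<omega> = n"
    unfolding passage_def
  proof (rule Least_equality)
    show "m < X (Suc n) \<omega>" using n by simp
    show "n \<le> j" if "m < X (Suc j) \<omega>" for j
      using n that by (meson not_le runmax_le_iff)
  qed
qed

lemma AE_passage: "AE \<omega> in M. \<exists>n. m < X (Suc n) \<omega>"
proof -
  let ?A = "{\<omega> \<in> space M. \<forall>j. X (Suc j) \<omega> \<le> m}"
  have meas: "?A \<in> sets M"
    by (intro sets.sets_Collect_countable_All sets_X[where Q = "\<lambda>k. k \<le> m"]) simp
  have le: "prob ?A \<le> (1 - y (int m)) ^ n" for n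
  proof -
    have "prob ?A \<le> prob {\<omega> \<in> space M. runmax X n \<omega> \<le> m}"
      by (intro finite_measure_mono sets_runmax) (auto simp: runmax_le_iff)
    then show ?thesis by (simp add: prob_runmax_le)
  qed
  have "(\<lambda>n. (1 - y (int m)) ^ n) \<longlonglongrightarrow> 0"
    using y_pos[of "int m"] y_le_1[of "int m"] by (intro LIMSEQ_power_zero) auto
  then have "prob ?A \<le> 0"
    by (rule LIMSEQ_le_const) (use le in auto)
  then have "prob ?A = 0" using measure_nonneg[of M ?A] by simp
  then have "AE \<omega> in M. \<omega> \<notin> ?A" using meas by (simp add: prob_eq_0)
  then show ?thesis using AE_space by eventually_elim (auto simp: not_le)
qed

section \<open>Generating function of the records before a level\<close>

context
  fixes t :: real
begin

abbreviation z :: complex where "z \<equiv> iexp t"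

lemma norm_z_power: "cmod (z ^ n) = 1"
  by (simp add: norm_power)

definition U :: "nat \<Rightarrow> nat \<Rightarrow> complex" where
  "U n m = expectation (\<lambda>\<omega>. z ^ nrec X \<delta> n \<omega> * of_bool (runmax X n \<omega> \<le> m))"

text \<open>Agrees with \<open>U n (m - 1)\<close> for positive \<open>m\<close> and vanishes at 0,
  so \<open>U n m - U' n m\<close> is the contribution of a maximum equal to \<open>m\<close>, with
  no case distinction at level 0.\<close>

definition U' :: "nat \<Rightarrow> nat \<Rightarrow> complex" where
  "U' n m = expectation (\<lambda>\<omega>. z ^ nrec X \<delta> n \<omega> * of_bool (runmax X n \<omega> < m))"

lemma integrable_state:
  "integrable M (\<lambda>\<omega>. z ^ nrec X \<delta> n \<omega> * of_bool (Q (runmax X n \<omega>)))"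
  by (rule integrable_const_bound[where B = 1])
    (auto intro!: state_meas[where f = "\<lambda>a b. z ^ a * of_bool (Q b)"] simp: norm_mult norm_z_power)

lemma norm_U_le: "cmod (U n m) \<le> (1 - y (int m)) ^ n"
proof -
  have "cmod (U n m) \<le> expectation (\<lambda>\<omega>. cmod (z ^ nrec X \<delta> n \<omega> * of_bool (runmax X n \<omega> \<le> m)))"
    unfolding U_def by (rule integral_norm_bound)
  also have "\<dots> = expectation (\<lambda>\<omega>. of_bool (runmax X n \<omega> \<le> m))"
    by (simp add: norm_mult norm_z_power norm_of_bool)
  also have "\<dots> = (1 - y (int m)) ^ n"
    using expectation_of_bool(1)[OF sets_runmax, where ?'b = real] by (simp add: prob_runmax_le)
  finally show ?thesis .
qed

lemma summable_U: "summable (\<lambda>n. U n m)"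
proof (rule summable_comparison_test'[where N = 0])
  show "summable (\<lambda>n. (1 - y (int m)) ^ n)"
    using y_pos[of "int m"] y_le_1[of "int m"] by (intro summable_geometric) auto
qed (simp add: norm_U_le)

lemma U'_Suc: "U' n (Suc m) = U n m" and U'_0: "U' n 0 = 0"
  by (simp_all add: U'_def U_def less_Suc_eq_le)

lemma summable_U': "summable (\<lambda>n. U' n m)"
  by (cases m) (simp_all add: U'_Suc U'_0 summable_U)

lemma U_minus_U'_0: "U 0 m - U' 0 m = of_bool (m = 0)"
  by (simp add: U_def U'_def nrec_0 runmax_0 prob_space)

text \<open>Condition on the next observation. A maximum already at \<open>m\<close> stays there if
  the value is at most \<open>m + \<delta>\<close>, without a record, or in between up to
  \<open>m\<close>, with a record and weight \<open>z\<close>. Reaching \<open>m\<close> from below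
  requires the value \<open>m\<close>, which is a \<open>\<delta>\<close>-record because
  \<open>\<delta> < 0\<close>.\<close>

lemma U_minus_U'_Suc:
  "U (Suc n) m - U' (Suc n) m =
    (U n m - U' n m) * (1 - y (int m + \<delta>) + z * (y (int m + \<delta>) - y (int m))) + U' n m * (z * p m)"
proof -
  define u where "u n = expectation (\<lambda>\<omega>. z ^ nrec X \<delta> n \<omega> * of_bool (runmax X n \<omega> = m))" for n
  have u: "u n = U n m - U' n m" for n
  proof -
    have "of_bool (k = m) = of_bool (k \<le> m) - (of_bool (k < m) :: complex)" for k by auto
    then have "u n = expectation (\<lambda>\<omega>. z ^ nrec X \<delta> n \<omega> * of_bool (runmax X n \<omega> \<le> m) -
        z ^ nrec X \<delta> n \<omega> * of_bool (runmax X n \<omega> < m))"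
      by (simp only: u_def right_diff_distrib)
    also have "\<dots> = U n m - U' n m"
      unfolding U_def U'_def by (intro Bochner_Integration.integral_diff integrable_state)
    finally show ?thesis .
  qed
  define g where "g k = of_bool (int k \<le> int m + \<delta>) + z * (of_bool (int k \<le> int m) - of_bool (int k \<le> int m + \<delta>))" for k
  have b: "{\<omega> \<in> space M. int (X (Suc n) \<omega>) \<le> j} \<in> sets M" for j
    using sets_X[of "Suc n" "\<lambda>k. int k \<le> j"] by simp
  have Eg: "expectation (\<lambda>\<omega>. g (X (Suc n) \<omega>)) = 1 - y (int m + \<delta>) + z * (y (int m + \<delta>) - y (int m))"
  proof -
    have "expectation (\<lambda>\<omega>. g (X (Suc n) \<omega>)) = expectation (\<lambda>\<omega>. of_bool (int (X (Suc n) \<omega>) \<le> int m + \<delta>)) +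
        z * (expectation (\<lambda>\<omega>. of_bool (int (X (Suc n) \<omega>) \<le> int m)) -
          expectation (\<lambda>\<omega>. of_bool (int (X (Suc n) \<omega>) \<le> int m + \<delta>)))"
      unfolding g_def
      by (simp only: Bochner_Integration.integral_add Bochner_Integration.integral_diff
          integral_mult_right_zero expectation_of_bool(2)[OF b] Bochner_Integration.integrable_diff
          integrable_mult_right)
    then show ?thesis by (simp only: expectation_of_bool(1)[OF b] prob_X_le[of "Suc n"]) simp
  qed
  have Eh: "expectation (\<lambda>\<omega>. of_bool (X (Suc n) \<omega> = m) * z) = z * p m"
    using sets_X[of "Suc n" "\<lambda>k. k = m"] by (simp add: expectation_of_bool X_dist)
  have pt: "z ^ nrec X \<delta> (Suc n) \<omega> * of_bool (runmax X (Suc n) \<omega> = m) =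
      z ^ nrec X \<delta> n \<omega> * of_bool (runmax X n \<omega> = m) * g (X (Suc n) \<omega>) +
      z ^ nrec X \<delta> n \<omega> * of_bool (runmax X n \<omega> < m) * (of_bool (X (Suc n) \<omega> = m) * z)" for \<omega>
    using delta_neg by (auto simp: nrec_Suc runmax_Suc g_def max_def)
  have ng: "cmod (g k) \<le> 1" for k
    using delta_neg by (auto simp: g_def)
  have i1: "integrable M (\<lambda>\<omega>. z ^ nrec X \<delta> n \<omega> * of_bool (runmax X n \<omega> = m) * g (X (Suc n) \<omega>))"
    using delta_neg
    by (intro integrable_const_bound[where B = 1] AE_I2)
      (auto simp: norm_mult norm_z_power ng intro!: borel_measurable_times state_meas[where f = "\<lambda>a b. z ^ a * of_bool (b = m)"]
         measurable_compose[OF X_meas])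
  have i2: "integrable M (\<lambda>\<omega>. z ^ nrec X \<delta> n \<omega> * of_bool (runmax X n \<omega> < m) * (of_bool (X (Suc n) \<omega> = m) * z))"
    by (intro integrable_const_bound[where B = 1] AE_I2)
      (auto simp: norm_mult norm_z_power intro!: borel_measurable_times state_meas[where f = "\<lambda>a b. z ^ a * of_bool (b < m)"]
         measurable_compose[OF X_meas])
  have "u (Suc n) = expectation (\<lambda>\<omega>. z ^ nrec X \<delta> n \<omega> * of_bool (runmax X n \<omega> = m) * g (X (Suc n) \<omega>)) +
      expectation (\<lambda>\<omega>. z ^ nrec X \<delta> n \<omega> * of_bool (runmax X n \<omega> < m) * (of_bool (X (Suc n) \<omega> = m) * z))"
    unfolding u_def pt by (rule Bochner_Integration.integral_add[OF i1 i2])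
  also have "expectation (\<lambda>\<omega>. z ^ nrec X \<delta> n \<omega> * of_bool (runmax X n \<omega> = m) * g (X (Suc n) \<omega>)) =
      u n * expectation (\<lambda>\<omega>. g (X (Suc n) \<omega>))"
    unfolding u_def
    by (rule expectation_mult_next[where f = "\<lambda>a b. z ^ a * of_bool (b = m)" and B = 1 and C = 1])
      (auto simp: norm_mult norm_z_power ng)
  also have "expectation (\<lambda>\<omega>. z ^ nrec X \<delta> n \<omega> * of_bool (runmax X n \<omega> < m) * (of_bool (X (Suc n) \<omega> = m) * z)) =
      U' n m * expectation (\<lambda>\<omega>. of_bool (X (Suc n) \<omega> = m) * z)"
    unfolding U'_def
    by (rule expectation_mult_next[where f = "\<lambda>a b. z ^ a * of_bool (b < m)" and g = "\<lambda>k. of_bool (k = m) * z" and B = 1 and C = 1])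
      (auto simp: norm_mult norm_z_power)
  finally show ?thesis unfolding u Eg Eh .
qed

text \<open>Sum the one-step relation over \<open>n\<close>. The shift leaves over the term at
  \<open>n = 0\<close>, nonzero only at level 0, where the maximum starts.\<close>

lemma sum_U_recursion:
  "((\<Sum>n. U n m) - (\<Sum>n. U' n m)) * (y (int m + \<delta>) - z * (y (int m + \<delta>) - y (int m))) =
    of_bool (m = 0) + z * p m * (\<Sum>n. U' n m)"
proof -
  define H where "H = (\<Sum>n. U n m - U' n m)"
  define a where "a = 1 - y (int m + \<delta>) + z * (y (int m + \<delta>) - y (int m))"
  have sm: "summable (\<lambda>n. U n m - U' n m)" by (intro summable_diff summable_U summable_U')
  have "H - of_bool (m = 0) = (\<Sum>n. U (Suc n) m - U' (Suc n) m)"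
    using suminf_split_head[OF sm] by (simp add: H_def U_minus_U'_0)
  also have "\<dots> = (\<Sum>n. (U n m - U' n m) * a + U' n m * (z * p m))"
    by (simp add: U_minus_U'_Suc a_def)
  also have "\<dots> = (\<Sum>n. (U n m - U' n m) * a) + (\<Sum>n. U' n m * (z * p m))"
    by (intro suminf_add[symmetric] summable_mult2 sm summable_U')
  also have "\<dots> = H * a + (\<Sum>n. U' n m) * (z * p m)"
    using sm summable_U' by (simp add: suminf_mult2 H_def)
  finally have "H * (1 - a) = of_bool (m = 0) + z * p m * (\<Sum>n. U' n m)"
    by (simp add: algebra_simps)
  moreover have "H = (\<Sum>n. U n m) - (\<Sum>n. U' n m)"
    unfolding H_def by (intro suminf_diff[symmetric] summable_U summable_U')
  ultimately show ?thesis by (simp add: a_def)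
qed

text \<open>The relation is a first-order recursion in \<open>m\<close> whose coefficient
  \<open>D m\<close> equals \<open>z * y m * (1 + x m)\<close> and so never vanishes. Solving it
  contributes a factor \<open>1 - r + r / (1 + x)\<close> for each new level.\<close>

lemma sum_U_eq_prod: "y (int m) * (\<Sum>n. U n m) = (\<Prod>k\<le>m. geom_char (r k) (q k) (-t))"
proof -
  define \<zeta> where "\<zeta> = z"
  define D where "D m = y (int m + \<delta>) - \<zeta> * (y (int m + \<delta>) - y (int m))" for m
  define x where "x m = (1 / \<zeta> - 1) / complex_of_real (q m)" for m
  have \<zeta>: "\<zeta> \<noteq> 0" by (simp add: \<zeta>_def)
  have "iexp (-t) = 1 / \<zeta>" by (simp add: \<zeta>_def exp_minus inverse_eq_divide)
  then have x: "x m = (iexp (-t) - 1) / complex_of_real (q m)" for m by (simp only: x_def)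
  have x1: "1 + x m \<noteq> 0" for m
    using one_plus_iexp_quotient_ge[OF q_bounds(1)[of m] q_bounds(3)[of m], of "-t"]
    unfolding x by auto
  have Dx: "D m = \<zeta> * y (int m) * (1 + x m)" for m
    using y_nonzero \<zeta> by (simp add: D_def x_def q_def field_simps)
  have D0: "D m \<noteq> 0" for m using x1[of m] y_nonzero \<zeta> by (simp add: Dx)
  have gc: "geom_char (r m) (q m) (-t) = 1 - r m * x m / (1 + x m)" for m
    unfolding geom_char_def Let_def x ..
  show ?thesis
  proof (induction m)
    case 0
    have "(\<Sum>n. U n 0) * D 0 = 1"
      using sum_U_recursion[of 0] by (simp add: U'_0 D_def \<zeta>_def)
    then have F: "(\<Sum>n. U n 0) = 1 / D 0" using D0[of 0] by (simp add: field_simps)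
    \<comment> \<open>Level 0 is occupied from the start and every observation made there is a
      record, which gives a geometric law on {0, 1, ...}. This is a Bernoulli variable with
      parameter \<open>1 - y 0\<close> times a geometric one on {1, 2, ...}, so the factor has the
      common form.\<close>
    have q0: "q 0 = y 0" "r 0 = 1 - y 0" using delta_neg by (simp_all add: q_def r_eq y_neg)
    have "1 + y 0 * x 0 = 1 / \<zeta>" using y_nonzero by (simp add: x_def q0)
    moreover have "1 - r 0 * x 0 / (1 + x 0) = (1 + y 0 * x 0) / (1 + x 0)"
      using x1[of 0] by (simp add: q0 field_simps)
    ultimately have "geom_char (r 0) (q 0) (-t) = 1 / (\<zeta> * (1 + x 0))" unfolding gc by simp
    also have "\<dots> = y 0 * (1 / D 0)" using Dx[of 0] y_nonzero by simp
    finally show ?case by (simp add: F)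
  next
    case (Suc m)
    let ?F = "\<Sum>n. U n m" and ?G = "\<Sum>n. U n (Suc m)" and ?k = "Suc m"
    have "(?G - ?F) * D ?k = \<zeta> * p ?k * ?F"
      using sum_U_recursion[of ?k] by (simp add: U'_Suc D_def \<zeta>_def)
    then have "?G - ?F = \<zeta> * p ?k * ?F / D ?k" using D0[of ?k] by (simp add: field_simps)
    then have G: "?G = ?F * (1 + \<zeta> * p ?k / D ?k)" by (simp add: algebra_simps)
    have ps: "p ?k = r ?k * y (int m)" using y_nonzero by (simp add: rr_def)
    have ys: "y (int ?k) = (1 - r ?k) * y (int m)" unfolding one_minus_r using y_nonzero by simp
    have "y (int ?k) * (1 + \<zeta> * p ?k / D ?k) = y (int m) * geom_char (r ?k) (q ?k) (-t)"
    proof -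
      have alg: "A * (1 + B / (A * c)) = A + B / c" if "A \<noteq> 0" for A B c :: complex
        using that by (cases "c = 0") (simp_all add: field_simps)
      have "\<zeta> * p ?k / D ?k = r ?k * y (int m) / (y (int ?k) * (1 + x ?k))"
        unfolding Dx ps using \<zeta> by simp
      then have "y (int ?k) * (1 + \<zeta> * p ?k / D ?k) = y (int ?k) + r ?k * y (int m) / (1 + x ?k)"
        using alg[of "of_real (y (int ?k))" "r ?k * y (int m)" "1 + x ?k"] y_nonzero[of "int ?k"] by simp
      also have "\<dots> = y (int m) * (1 - r ?k + r ?k / (1 + x ?k))"
        unfolding ys by (simp add: algebra_simps)
      also have "1 - r ?k + r ?k / (1 + x ?k) = geom_char (r ?k) (q ?k) (-t)"
        unfolding gc using x1[of ?k] by (simp add: field_simps)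
      finally show ?thesis .
    qed
    then have "y (int ?k) * ?G = y (int m) * ?F * geom_char (r ?k) (q ?k) (-t)"
      unfolding G by (simp add: ac_simps)
    then show ?case using Suc by simp
  qed
qed

text \<open>Split by the value \<open>n\<close> of \<open>passage m\<close>: the maximum after
  \<open>n\<close> steps is at most \<open>m\<close>, and the next observation exceeds
  \<open>m\<close> independently with probability \<open>y m\<close>. The probabilities that the
  maximum is still at most \<open>m\<close> form a geometric series, which permits exchanging sum
  and expectation.\<close>

lemma expectation_z_power_S: "expectation (\<lambda>\<omega>. z ^ S m \<omega>) = (\<Prod>k\<le>m. geom_char (r k) (q k) (-t))"
proof -
  define f where "f n \<omega> = z ^ nrec X \<delta> n \<omega> * of_bool (runmax X n \<omega> \<le> m) * of_bool (m < X (Suc n) \<omega>)" for n \<omega>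
  have sX: "{\<omega> \<in> space M. m < X (Suc n) \<omega>} \<in> sets M" for n
    using sets_X[of "Suc n" "\<lambda>k. m < k"] by simp
  have pX: "prob {\<omega> \<in> space M. m < X (Suc n) \<omega>} = y (int m)" for n
  proof -
    have "{\<omega> \<in> space M. m < X (Suc n) \<omega>} = space M - {\<omega> \<in> space M. int (X (Suc n) \<omega>) \<le> int m}" by auto
    then show ?thesis
      using prob_compl[of "{\<omega> \<in> space M. int (X (Suc n) \<omega>) \<le> int m}"] sets_X[of "Suc n" "\<lambda>k. int k \<le> int m"]
        prob_X_le[of "Suc n" "int m"] by simp
  qed
  have fm: "f n \<in> borel_measurable M" for n
    unfolding f_def[abs_def]
    by (intro borel_measurable_times[OF state_meas[where f = "\<lambda>a b. z ^ a * of_bool (b \<le> m)"]] measurable_compose[OF X_meas]) auto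
  have int: "integrable M (f n)" for n
    using fm by (intro integrable_const_bound[where B = 1] AE_I2) (auto simp: f_def norm_mult norm_z_power)
  have Ef: "expectation (f n) = U n m * y (int m)" for n
  proof -
    have "expectation (f n) = U n m * expectation (\<lambda>\<omega>. of_bool (m < X (Suc n) \<omega>))"
      unfolding f_def U_def
      by (rule expectation_mult_next[where f = "\<lambda>a b. z ^ a * of_bool (b \<le> m)" and g = "\<lambda>k. of_bool (m < k)" and B = 1 and C = 1])
       (auto simp: norm_mult norm_z_power)
    then show ?thesis by (simp add: expectation_of_bool sX pX)
  qed
  have single: "(\<lambda>n. f n \<omega>) = (\<lambda>n. if n = passage m \<omega> then z ^ S m \<omega> else 0)"
    if "\<exists>n. m < X (Suc n) \<omega>" for \<omega>
  proof
    show "f n \<omega> = (if n = passage m \<omega> then z ^ S m \<omega> else 0)" for n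
      using passage_eq_iff[OF that, of n] by (cases "n = passage m \<omega>") (auto simp: f_def S_def)
  qed
  have "(\<lambda>n. expectation (f n)) sums expectation (\<lambda>\<omega>. \<Sum>n. f n \<omega>)"
  proof (rule sums_integral[OF int])
    show "AE \<omega> in M. summable (\<lambda>n. norm (f n \<omega>))"
      using AE_passage[of m]
    proof eventually_elim
      case (elim \<omega>)
      have "(\<lambda>n. norm (f n \<omega>)) = (\<lambda>n. if n = passage m \<omega> then norm (z ^ S m \<omega>) else 0)"
        using single[OF elim] by (auto simp: fun_eq_iff)
      then show ?case by (simp add: summable_single)
    qed
    show "summable (\<lambda>n. expectation (\<lambda>\<omega>. norm (f n \<omega>)))"
    proof (rule summable_comparison_test'[where N = 0])
      show "summable (\<lambda>n. (1 - y (int m)) ^ n)"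
        using y_pos[of "int m"] y_le_1[of "int m"] by (intro summable_geometric) auto
      fix n
      have "expectation (\<lambda>\<omega>. norm (f n \<omega>)) \<le> expectation (\<lambda>\<omega>. of_bool (runmax X n \<omega> \<le> m))"
        by (intro integral_mono integrable_norm[OF int] expectation_of_bool(2) sets_runmax)
          (auto simp: f_def norm_mult norm_z_power)
      also have "\<dots> = (1 - y (int m)) ^ n"
        using expectation_of_bool(1)[OF sets_runmax, where ?'b = real] by (simp add: prob_runmax_le)
      finally show "norm (expectation (\<lambda>\<omega>. norm (f n \<omega>))) \<le> (1 - y (int m)) ^ n" by simp
    qed
  qed
  then have "expectation (\<lambda>\<omega>. \<Sum>n. f n \<omega>) = (\<Sum>n. U n m * y (int m))"
    by (simp add: Ef sums_iff)
  also have "\<dots> = y (int m) * (\<Sum>n. U n m)"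
    using suminf_mult2[OF summable_U[of m], of "of_real (y (int m))"] by (simp add: mult.commute)
  also have "\<dots> = (\<Prod>k\<le>m. geom_char (r k) (q k) (-t))" by (rule sum_U_eq_prod)
  also have "expectation (\<lambda>\<omega>. \<Sum>n. f n \<omega>) = expectation (\<lambda>\<omega>. z ^ S m \<omega>)"
  proof (rule integral_cong_AE)
    show "(\<lambda>\<omega>. \<Sum>n. f n \<omega>) \<in> borel_measurable M" using fm by (rule borel_measurable_suminf)
    show "(\<lambda>\<omega>. z ^ S m \<omega>) \<in> borel_measurable M" by (rule measurable_compose[OF S_meas]) simp
    show "AE \<omega> in M. (\<Sum>n. f n \<omega>) = z ^ S m \<omega>"
      using AE_passage[of m]
    proof eventually_elim
      case (elim \<omega>)
      show ?case unfolding single[OF elim]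
        using sums_single[of "passage m \<omega>" "\<lambda>_. z ^ S m \<omega>"] by (simp add: sums_iff)
    qed
  qed
  finally show ?thesis .
qed

end

end

section \<open>Central limit theorem along levels\<close>

context record_model
begin

text \<open>Level, centring and scale are separate sequences because the result is applied at levels
  near \<open>lvl n\<close> with the constants belonging to \<open>lvl n\<close> itself.\<close>

lemma S_CLT:
  assumes L: lyapunov and c: "filterlim c at_top sequentially"
    and \<sigma>: "\<And>n. 0 \<le> \<sigma> n"
    and wc: "(\<lambda>n. w (c n) / (\<sigma> n)\<^sup>2) \<longlonglongrightarrow> 1"
    and \<mu>c: "(\<lambda>n. (\<mu> (c n) - a n) / \<sigma> n) \<longlonglongrightarrow> 0"
  shows "weak_conv_m (\<lambda>n. distr M borel (\<lambda>\<omega>. (real (S (c n) \<omega>) - a n) / \<sigma> n)) std_normal_distribution"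
proof (rule levy_continuity)
  have meas: "(\<lambda>\<omega>. (real (S (c n) \<omega>) - a n) / \<sigma> n) \<in> borel_measurable M" for n
    by (rule measurable_compose[OF S_meas]) simp
  then show "real_distribution (distr M borel (\<lambda>\<omega>. (real (S (c n) \<omega>) - a n) / \<sigma> n))" for n
    by (rule real_distribution_distr)
  show "real_distribution std_normal_distribution" by (rule real_dist_normal_dist)
  fix t :: real
  define u where "u n = t / \<sigma> n" for n
  define G where "G n = (\<Prod>k\<le>c n. geom_char (r k) (q k) (- u n) * iexp (- (u n * (r k / q k))))" for n
  have char: "char (distr M borel (\<lambda>\<omega>. (real (S (c n) \<omega>) - a n) / \<sigma> n)) t =
      iexp (t * ((\<mu> (c n) - a n) / \<sigma> n)) * G n" for n
  proof -
    have "char (distr M borel (\<lambda>\<omega>. (real (S (c n) \<omega>) - a n) / \<sigma> n)) t =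
        expectation (\<lambda>\<omega>. iexp (t * ((real (S (c n) \<omega>) - a n) / \<sigma> n)))"
      unfolding char_def by (rule integral_distr[OF meas]) simp
    also have "\<dots> = expectation (\<lambda>\<omega>. iexp (- (u n * a n)) * iexp (u n) ^ S (c n) \<omega>)"
      by (intro arg_cong[where f = "integral\<^sup>L M"])
        (simp add: fun_eq_iff u_def exp_of_nat_mult[symmetric] exp_add[symmetric] algebra_simps diff_divide_distrib)
    also have "\<dots> = iexp (- (u n * a n)) * (\<Prod>k\<le>c n. geom_char (r k) (q k) (- u n))"
      by (simp add: expectation_z_power_S[of "u n" "c n"])
    also have "iexp (- (u n * a n)) = iexp (t * ((\<mu> (c n) - a n) / \<sigma> n)) * iexp (- (u n * \<mu> (c n)))"
      by (simp add: exp_add[symmetric] u_def algebra_simps diff_divide_distrib)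
    also have "iexp (- (u n * \<mu> (c n))) = (\<Prod>k\<le>c n. iexp (- (u n * (r k / q k))))"
      by (simp add: \<mu>_def sum_distrib_left sum_negf exp_sum[symmetric])
    finally show ?thesis
      by (simp add: G_def prod.distrib ac_simps)
  qed
  \<comment> \<open>A quotient by 0 is 0, so convergence to 1 forces \<open>\<sigma> n\<close> to be
    nonzero eventually. The bound 4 is any constant above 1 with a convenient square root.\<close>
  have ev\<sigma>: "\<forall>\<^sub>F n in sequentially. 0 < \<sigma> n \<and> w (c n) / (\<sigma> n)\<^sup>2 < 4"
  proof -
    have "\<forall>\<^sub>F n in sequentially. 0 < w (c n) / (\<sigma> n)\<^sup>2" "\<forall>\<^sub>F n in sequentially. w (c n) / (\<sigma> n)\<^sup>2 < 4"
      using order_tendstoD[OF wc] by auto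
    then show ?thesis
    proof eventually_elim
      case (elim n)
      then have "\<sigma> n \<noteq> 0" by auto
      then show ?case using elim \<sigma>[of n] by simp
    qed
  qed
  have G: "(\<lambda>n. G n - of_real (exp (- (t\<^sup>2 / 2 * (w (c n) / (\<sigma> n)\<^sup>2))))) \<longlonglongrightarrow> 0"
  proof (rule tendstoI)
    fix e :: real assume e: "0 < e"
    \<comment> \<open>The first bound gives \<open>|u| \<le> q\<close> at every level, as
      \<open>geom_char_approx\<close> requires; the second keeps the total error
      \<open>12 * d * |t|^3 * 4\<close> below \<open>e\<close>.\<close>
    define d where "d = min (1 / (2 * (\<bar>t\<bar> + 1))) (e / (48 * (\<bar>t\<bar> ^ 3 + 1)))"
    have t3: "0 < \<bar>t\<bar> ^ 3 + 1" by (simp add: add_nonneg_pos)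
    have d0: "0 < d" using e t3 by (auto simp: d_def)
    have d1: "2 * d * \<bar>t\<bar> \<le> 1"
    proof -
      have "2 * d * \<bar>t\<bar> \<le> 2 * (1 / (2 * (\<bar>t\<bar> + 1))) * \<bar>t\<bar>"
        by (intro mult_right_mono mult_left_mono) (auto simp: d_def)
      also have "\<dots> \<le> 1" by (simp add: field_simps)
      finally show ?thesis .
    qed
    have d2: "48 * d * \<bar>t\<bar> ^ 3 < e"
    proof -
      have "48 * d * \<bar>t\<bar> ^ 3 \<le> 48 * (e / (48 * (\<bar>t\<bar> ^ 3 + 1))) * \<bar>t\<bar> ^ 3"
        by (intro mult_right_mono mult_left_mono) (auto simp: d_def)
      also have "\<dots> < e" using e t3 by (simp add: field_simps)
      finally show ?thesis .
    qed
    have "\<forall>\<^sub>F n in sequentially. \<forall>k\<le>c n. 1 / q k \<le> d * sqrt (w (c n))"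
      using c lyapunov_uniform[OF L d0] by (rule filterlim_iff[THEN iffD1, rule_format])
    with ev\<sigma> show "\<forall>\<^sub>F n in sequentially.
        dist (G n - of_real (exp (- (t\<^sup>2 / 2 * (w (c n) / (\<sigma> n)\<^sup>2))))) 0 < e"
    proof eventually_elim
      case (elim n)
      have s: "0 < \<sigma> n" and w4: "w (c n) / (\<sigma> n)\<^sup>2 < 4" using elim by auto
      have sw: "sqrt (w (c n)) \<le> 2 * \<sigma> n"
      proof (rule real_le_lsqrt)
        show "w (c n) \<le> (2 * \<sigma> n)\<^sup>2" using w4 s by (simp add: field_simps power2_eq_square)
      qed (use s in auto)
      have uq: "\<bar>u n\<bar> / q k \<le> 2 * d * \<bar>t\<bar>" if "k \<le> c n" for k
      proof -
        have "1 / q k \<le> d * sqrt (w (c n))" using elim that by blast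
        also have "\<dots> \<le> d * (2 * \<sigma> n)" using sw d0 by (intro mult_left_mono) auto
        finally have "\<bar>u n\<bar> * (1 / q k) \<le> \<bar>u n\<bar> * (d * (2 * \<sigma> n))" by (intro mult_left_mono) auto
        then show ?thesis using s by (simp add: u_def abs_divide ac_simps)
      qed
      have uq1: "\<bar>u n\<bar> \<le> q k" if "k \<le> c n" for k
        using order_trans[OF uq[OF that] d1] q_bounds(1)[of k] by (simp add: pos_divide_le_eq)
      have ex: "exp (- (t\<^sup>2 / 2 * (w (c n) / (\<sigma> n)\<^sup>2))) = (\<Prod>k\<le>c n. exp (- ((u n)\<^sup>2 * v k / 2)))"
        by (simp add: exp_sum[symmetric] sum_negf w_def u_def power_divide sum_distrib_left sum_divide_distrib mult.commute)
      \<comment> \<open>All factors of both products have modulus at most 1, so the difference of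
        the products is at most the sum of the differences of the factors.\<close>
      have "cmod (G n - of_real (exp (- (t\<^sup>2 / 2 * (w (c n) / (\<sigma> n)\<^sup>2))))) \<le>
          (\<Sum>k\<le>c n. cmod (geom_char (r k) (q k) (- u n) * iexp (- (u n * (r k / q k))) - of_real (exp (- ((u n)\<^sup>2 * v k / 2)))))"
        unfolding ex G_def of_real_prod
      proof (rule norm_prod_diff)
        fix k
        show "cmod (geom_char (r k) (q k) (- u n) * iexp (- (u n * (r k / q k)))) \<le> 1"
          using norm_geom_char_le_1[of "r k" "q k" "- u n"] r_bounds[of k] q_bounds(1,3)[of k]
          by (simp add: norm_mult)
        show "cmod (of_real (exp (- ((u n)\<^sup>2 * v k / 2)))) \<le> 1"
          using v_pos[of k] by simp
      qed
      also have "\<dots> \<le> (\<Sum>k\<le>c n. 12 * d * \<bar>t\<bar> * (u n)\<^sup>2 * v k)"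
      proof (rule sum_mono)
        fix k assume "k \<in> {..c n}"
        then have k: "k \<le> c n" by simp
        have "cmod (geom_char (r k) (q k) (- u n) * iexp (- (u n * (r k / q k))) - of_real (exp (- ((u n)\<^sup>2 * v k / 2))))
            \<le> 6 * (r k * (\<bar>u n\<bar> / q k) ^ 3)"
          unfolding v_def using r_bounds[of k] q_bounds(1,3)[of k] uq1[OF k]
          by (intro geom_char_approx) auto
        also have "\<dots> = 6 * (\<bar>u n\<bar> / q k) * (u n)\<^sup>2 * (r k / (q k)\<^sup>2)"
          by (simp add: power3_eq_cube power2_eq_square abs_mult_self_eq ac_simps)
        also have "\<dots> \<le> 6 * (2 * d * \<bar>t\<bar>) * (u n)\<^sup>2 * v k"
        proof (rule mult_mono)
          show "6 * (\<bar>u n\<bar> / q k) * (u n)\<^sup>2 \<le> 6 * (2 * d * \<bar>t\<bar>) * (u n)\<^sup>2"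
            using uq[OF k] by (intro mult_right_mono mult_left_mono) auto
          show "r k / (q k)\<^sup>2 \<le> v k" by (rule v_ge)
        qed (use d0 r_bounds(1)[of k] in auto)
        finally show "cmod (geom_char (r k) (q k) (- u n) * iexp (- (u n * (r k / q k))) - of_real (exp (- ((u n)\<^sup>2 * v k / 2))))
            \<le> 12 * d * \<bar>t\<bar> * (u n)\<^sup>2 * v k" by simp
      qed
      also have "\<dots> = 12 * d * \<bar>t\<bar> * (u n)\<^sup>2 * w (c n)"
        by (simp add: w_def sum_distrib_left)
      also have "\<dots> = 12 * d * \<bar>t\<bar> ^ 3 * (w (c n) / (\<sigma> n)\<^sup>2)"
        by (simp add: u_def power_divide power3_eq_cube power2_eq_square abs_mult_self_eq ac_simps)
      also have "\<dots> \<le> 12 * d * \<bar>t\<bar> ^ 3 * 4"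
        using w4 d0 by (intro mult_left_mono) auto
      also have "\<dots> < e" using d2 by simp
      finally show ?case by simp
    qed
  qed
  have "(\<lambda>n. complex_of_real (exp (- (t\<^sup>2 / 2 * (w (c n) / (\<sigma> n)\<^sup>2))))) \<longlonglongrightarrow> of_real (exp (- (t\<^sup>2 / 2 * 1)))"
    by (intro tendsto_intros wc)
  from tendsto_add[OF G this] have "G \<longlonglongrightarrow> of_real (exp (- (t\<^sup>2 / 2)))" by simp
  moreover have "(\<lambda>n. iexp (t * ((\<mu> (c n) - a n) / \<sigma> n))) \<longlonglongrightarrow> iexp (t * 0)"
    by (intro tendsto_intros \<mu>c)
  ultimately have "(\<lambda>n. iexp (t * ((\<mu> (c n) - a n) / \<sigma> n)) * G n) \<longlonglongrightarrow> iexp (t * 0) * of_real (exp (- (t\<^sup>2 / 2)))"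
    by (intro tendsto_mult)
  then show "(\<lambda>n. char (distr M borel (\<lambda>\<omega>. (real (S (c n) \<omega>) - a n) / \<sigma> n)) t) \<longlonglongrightarrow> char std_normal_distribution t"
    by (simp add: char char_std_normal_distribution)
qed

lemma S_le_nrec: "m < runmax X n \<omega> \<Longrightarrow> S m \<omega> \<le> nrec X \<delta> n \<omega>"
proof -
  assume "m < runmax X n \<omega>"
  then have "\<not> runmax X n \<omega> \<le> m" by simp
  then obtain j where j: "j < n" "m < X (Suc j) \<omega>" unfolding runmax_le_iff by (auto simp: not_le)
  then have "passage m \<omega> \<le> j" unfolding passage_def by (intro Least_le)
  then show ?thesis using j unfolding S_def by (intro nrec_mono) simp
qed

text \<open>The existence hypothesis excludes the junk value of \<open>passage\<close>. It holds
  almost surely, which is why the sandwich below compares events up to null sets.\<close>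

lemma nrec_le_S: "runmax X n \<omega> \<le> m \<Longrightarrow> \<exists>n. m < X (Suc n) \<omega> \<Longrightarrow> nrec X \<delta> n \<omega> \<le> S m \<omega>"
proof -
  assume n: "runmax X n \<omega> \<le> m" and ex: "\<exists>n. m < X (Suc n) \<omega>"
  have "m < X (Suc (passage m \<omega>)) \<omega>" using passage_eq_iff[OF ex, of "passage m \<omega>"] by simp
  then have "n \<le> passage m \<omega>" using n unfolding runmax_le_iff by (meson not_le)
  then show ?thesis unfolding S_def by (rule nrec_mono)
qed

text \<open>Bernoulli's inequality bounds the probability of staying at or below \<open>b\<close>
  from below, and \<open>1 - x \<le> exp (- x)\<close> bounds that of staying at or below
  \<open>a\<close> from above.\<close>

lemma prob_runmax_between:
  assumes "a \<le> b"
  shows "1 - real n * y (int b) - exp (- (real n * y (int a))) \<le> prob {\<omega> \<in> space M. a < runmax X n \<omega> \<and> runmax X n \<omega> \<le> b}"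
proof -
  have "{\<omega> \<in> space M. a < runmax X n \<omega> \<and> runmax X n \<omega> \<le> b} =
      {\<omega> \<in> space M. runmax X n \<omega> \<le> b} - {\<omega> \<in> space M. runmax X n \<omega> \<le> a}" by auto
  also have "prob \<dots> = (1 - y (int b)) ^ n - (1 - y (int a)) ^ n"
    using assms by (subst finite_measure_Diff[OF sets_runmax sets_runmax]) (auto simp: prob_runmax_le)
  finally have eq: "prob {\<omega> \<in> space M. a < runmax X n \<omega> \<and> runmax X n \<omega> \<le> b} = \<dots>" .
  have "1 + real n * (- y (int b)) \<le> (1 + (- y (int b))) ^ n"
    using y_le_1[of "int b"] by (intro Bernoulli_inequality) simp
  moreover have "(1 - y (int a)) ^ n \<le> exp (- y (int a)) ^ n"
    using y_le_1[of "int a"] exp_ge_add_one_self[of "- y (int a)"] by (intro power_mono) auto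
  moreover have "exp (- y (int a)) ^ n = exp (- (real n * y (int a)))"
    by (simp add: exp_of_nat_mult[symmetric])
  ultimately show ?thesis unfolding eq by simp
qed

text \<open>The levels may depend on \<open>e\<close>: for each \<open>e\<close> the distribution
  function of the count is enclosed between those at the two levels up to the probability of a bad
  event, and both enclosing functions have the same limit.\<close>

lemma nrec_CLT_sandwich:
  fixes a \<sigma> :: "nat \<Rightarrow> real"
  assumes \<sigma>: "\<And>n. 0 \<le> \<sigma> n"
    and S: "\<And>e. 0 < e \<Longrightarrow> \<exists>\<alpha> \<beta>.
      weak_conv_m (\<lambda>n. distr M borel (\<lambda>\<omega>. (real (S (\<alpha> n) \<omega>) - a n) / \<sigma> n)) std_normal_distribution \<and>
      weak_conv_m (\<lambda>n. distr M borel (\<lambda>\<omega>. (real (S (\<beta> n) \<omega>) - a n) / \<sigma> n)) std_normal_distribution \<and>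
      (\<forall>\<^sub>F n in sequentially. 1 - e \<le> prob {\<omega> \<in> space M. \<alpha> n < runmax X n \<omega> \<and> runmax X n \<omega> \<le> \<beta> n})"
  shows "weak_conv_m (\<lambda>n. distr M borel (\<lambda>\<omega>. (real (nrec X \<delta> n \<omega>) - a n) / \<sigma> n)) std_normal_distribution"
  unfolding weak_conv_m_def weak_conv_def
proof (intro allI impI)
  fix x assume x: "isCont (cdf std_normal_distribution) x"
  define sc where "sc n k = (real k - a n) / \<sigma> n" for n k
  have sc_mono: "sc n k \<le> sc n l" if "k \<le> l" for n k l
    unfolding sc_def using that \<sigma>[of n] by (intro divide_right_mono) auto
  have cdf: "cdf (distr M borel (\<lambda>\<omega>. sc n (Y \<omega>))) x = prob {\<omega> \<in> space M. sc n (Y \<omega>) \<le> x}"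
    and sets: "{\<omega> \<in> space M. sc n (Y \<omega>) \<le> x} \<in> sets M"
    if Y: "Y \<in> measurable M (count_space UNIV)" for n and Y :: "'a \<Rightarrow> nat"
  proof -
    have m: "(\<lambda>\<omega>. sc n (Y \<omega>)) \<in> borel_measurable M" by (rule measurable_compose[OF Y]) simp
    have "(\<lambda>\<omega>. sc n (Y \<omega>)) -` {..x} \<inter> space M = {\<omega> \<in> space M. sc n (Y \<omega>) \<le> x}" by auto
    with measure_distr[OF m, of "{..x}"] measurable_sets[OF m, of "{..x}"]
    show "cdf (distr M borel (\<lambda>\<omega>. sc n (Y \<omega>))) x = prob {\<omega> \<in> space M. sc n (Y \<omega>) \<le> x}"
      "{\<omega> \<in> space M. sc n (Y \<omega>) \<le> x} \<in> sets M" by (simp_all add: cdf_def)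
  qed
  let ?\<Phi> = "cdf std_normal_distribution x"
  have "(\<lambda>n. prob {\<omega> \<in> space M. sc n (nrec X \<delta> n \<omega>) \<le> x}) \<longlonglongrightarrow> ?\<Phi>"
  proof (rule tendstoI)
    fix e :: real assume e: "0 < e"
    obtain \<alpha> \<beta> where
      \<alpha>: "weak_conv_m (\<lambda>n. distr M borel (\<lambda>\<omega>. sc n (S (\<alpha> n) \<omega>))) std_normal_distribution" and
      \<beta>: "weak_conv_m (\<lambda>n. distr M borel (\<lambda>\<omega>. sc n (S (\<beta> n) \<omega>))) std_normal_distribution" and
      A: "\<forall>\<^sub>F n in sequentially. 1 - e / 2 \<le> prob {\<omega> \<in> space M. \<alpha> n < runmax X n \<omega> \<and> runmax X n \<omega> \<le> \<beta> n}"
      using S[of "e / 2"] e unfolding sc_def by auto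
    have "(\<lambda>n. cdf (distr M borel (\<lambda>\<omega>. sc n (S (\<alpha> n) \<omega>))) x) \<longlonglongrightarrow> ?\<Phi>"
      using \<alpha> x unfolding weak_conv_m_def weak_conv_def by blast
    then have "(\<lambda>n. prob {\<omega> \<in> space M. sc n (S (\<alpha> n) \<omega>) \<le> x}) \<longlonglongrightarrow> ?\<Phi>"
      by (simp only: cdf[OF S_meas])
    then have \<alpha>': "\<forall>\<^sub>F n in sequentially. dist (prob {\<omega> \<in> space M. sc n (S (\<alpha> n) \<omega>) \<le> x}) ?\<Phi> < e / 2"
      using e by (intro tendstoD) auto
    have "(\<lambda>n. cdf (distr M borel (\<lambda>\<omega>. sc n (S (\<beta> n) \<omega>))) x) \<longlonglongrightarrow> ?\<Phi>"
      using \<beta> x unfolding weak_conv_m_def weak_conv_def by blast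
    then have "(\<lambda>n. prob {\<omega> \<in> space M. sc n (S (\<beta> n) \<omega>) \<le> x}) \<longlonglongrightarrow> ?\<Phi>"
      by (simp only: cdf[OF S_meas])
    then have \<beta>': "\<forall>\<^sub>F n in sequentially. dist (prob {\<omega> \<in> space M. sc n (S (\<beta> n) \<omega>) \<le> x}) ?\<Phi> < e / 2"
      using e by (intro tendstoD) auto
    from A \<alpha>' \<beta>' show "\<forall>\<^sub>F n in sequentially. dist (prob {\<omega> \<in> space M. sc n (nrec X \<delta> n \<omega>) \<le> x}) ?\<Phi> < e"
    proof eventually_elim
      case (elim n)
      let ?A = "{\<omega> \<in> space M. \<alpha> n < runmax X n \<omega> \<and> runmax X n \<omega> \<le> \<beta> n}"
      have As: "?A \<in> sets M"
      proof -
        have "?A = {\<omega> \<in> space M. runmax X n \<omega> \<le> \<beta> n} - {\<omega> \<in> space M. runmax X n \<omega> \<le> \<alpha> n}" by auto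
        then show ?thesis using sets_runmax by auto
      qed
      \<comment> \<open>An inclusion that holds only on \<open>?A\<close> costs the probability of
        its complement, at most \<open>e / 2\<close>.\<close>
      have union: "prob B \<le> prob C + e / 2"
        if "B \<in> sets M" "C \<in> sets M" "AE \<omega> in M. \<omega> \<in> B \<longrightarrow> \<omega> \<in> ?A \<longrightarrow> \<omega> \<in> C" for B C
      proof -
        have "prob B \<le> prob (C \<union> (space M - ?A))"
        proof (rule finite_measure_mono_AE)
          show "AE \<omega> in M. \<omega> \<in> B \<longrightarrow> \<omega> \<in> C \<union> (space M - ?A)"
            using that(3) AE_space by eventually_elim blast
        qed (use that As in auto)
        also have "\<dots> \<le> prob C + prob (space M - ?A)"
          using that As by (intro measure_Un_le) auto
        also have "prob (space M - ?A) = 1 - prob ?A" by (rule prob_compl[OF As])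
        finally show ?thesis using elim by simp
      qed
      have "prob {\<omega> \<in> space M. sc n (nrec X \<delta> n \<omega>) \<le> x} \<le> prob {\<omega> \<in> space M. sc n (S (\<alpha> n) \<omega>) \<le> x} + e / 2"
      proof (rule union[OF sets[OF nrec_meas] sets[OF S_meas]], rule AE_I2, intro impI)
        fix \<omega> assume "\<omega> \<in> {\<omega> \<in> space M. sc n (nrec X \<delta> n \<omega>) \<le> x}" "\<omega> \<in> ?A"
        then show "\<omega> \<in> {\<omega> \<in> space M. sc n (S (\<alpha> n) \<omega>) \<le> x}"
          using sc_mono[OF S_le_nrec[of "\<alpha> n" n \<omega>], of n] by simp
      qed
      moreover have "prob {\<omega> \<in> space M. sc n (S (\<beta> n) \<omega>) \<le> x} \<le> prob {\<omega> \<in> space M. sc n (nrec X \<delta> n \<omega>) \<le> x} + e / 2"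
      proof (rule union[OF sets[OF S_meas] sets[OF nrec_meas]])
        show "AE \<omega> in M. \<omega> \<in> {\<omega> \<in> space M. sc n (S (\<beta> n) \<omega>) \<le> x} \<longrightarrow> \<omega> \<in> ?A \<longrightarrow>
            \<omega> \<in> {\<omega> \<in> space M. sc n (nrec X \<delta> n \<omega>) \<le> x}"
          using AE_passage[of "\<beta> n"]
        proof eventually_elim
          case (elim \<omega>)
          then show ?case using sc_mono[OF nrec_le_S[of n \<omega> "\<beta> n"], of n] by auto
        qed
      qed
      ultimately show ?case using elim unfolding dist_real_def by linarith
    qed
  qed
  then show "(\<lambda>n. cdf (distr M borel (\<lambda>\<omega>. (real (nrec X \<delta> n \<omega>) - a n) / \<sigma> n)) x) \<longlonglongrightarrow> ?\<Phi>"
    using cdf[OF nrec_meas] unfolding sc_def by simp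
qed

end

section \<open>Comparison with a deterministic number of observations\<close>

lemma exp_minus_le_inverse:
  fixes x :: real
  assumes "0 < x"
  shows "exp (- x) \<le> 1 / x"
proof -
  have "x \<le> exp x" using exp_ge_add_one_self[of x] by linarith
  then have "1 / exp x \<le> 1 / x" using assms by (intro frac_le) auto
  then show ?thesis by (simp only: exp_minus inverse_eq_divide)
qed

context record_model
begin

abbreviation lvl :: "nat \<Rightarrow> nat" where "lvl n \<equiv> mm p (real n)"

text \<open>The conditions under which \<open>S_CLT\<close> applies at level
  \<open>\<alpha> n\<close> with the centring and scale of \<open>lvl n\<close>.\<close>

definition close_level :: "(nat \<Rightarrow> nat) \<Rightarrow> bool" where
  "close_level \<alpha> \<longleftrightarrow> filterlim \<alpha> at_top sequentially \<and> (\<lambda>n. w (\<alpha> n) / w (lvl n)) \<longlonglongrightarrow> 1 \<and>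
    (\<lambda>n. (\<mu> (\<alpha> n) - \<mu> (lvl n)) / sqrt (w (lvl n))) \<longlonglongrightarrow> 0"

lemma filterlim_lvl: "filterlim lvl at_top sequentially"
  by (rule filterlim_compose[OF filterlim_mm filterlim_real_sequentially])

lemma nrec_CLT:
  assumes L: lyapunov and V: "\<And>m. 0 \<le> V m" "(\<lambda>m. V m / w m) \<longlonglongrightarrow> 1"
    and close: "\<And>e. 0 < e \<Longrightarrow> \<exists>\<alpha> \<beta>. close_level \<alpha> \<and> close_level \<beta> \<and>
      (\<forall>\<^sub>F n in sequentially. \<alpha> n \<le> \<beta> n \<and> real n * y (int (\<beta> n)) + exp (- (real n * y (int (\<alpha> n)))) \<le> e)"
  shows "weak_conv_m (\<lambda>n. distr M borel (\<lambda>\<omega>. (real (nrec X \<delta> n \<omega>) - theta p \<delta> (lvl n)) / sqrt (V (lvl n))))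
    std_normal_distribution"
proof (rule nrec_CLT_sandwich)
  show "0 \<le> sqrt (V (lvl n))" for n using V(1) by simp
  have wV: "(\<lambda>n. w (lvl n) / V (lvl n)) \<longlonglongrightarrow> 1"
    using filterlim_compose[OF tendsto_inverse[OF V(2)] filterlim_lvl] by simp
  have S: "weak_conv_m (\<lambda>n. distr M borel (\<lambda>\<omega>. (real (S (\<alpha> n) \<omega>) - theta p \<delta> (lvl n)) / sqrt (V (lvl n))))
      std_normal_distribution" if \<alpha>: "close_level \<alpha>" for \<alpha>
  proof (rule S_CLT[OF L])
    show "filterlim \<alpha> at_top sequentially" using \<alpha> by (simp add: close_level_def)
    show "0 \<le> sqrt (V (lvl n))" for n using V(1) by simp
    have "(\<lambda>n. w (\<alpha> n) / w (lvl n) * (w (lvl n) / V (lvl n))) \<longlonglongrightarrow> 1 * 1"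
      using \<alpha> by (intro tendsto_mult wV) (simp add: close_level_def)
    then show "(\<lambda>n. w (\<alpha> n) / (sqrt (V (lvl n)))\<^sup>2) \<longlonglongrightarrow> 1"
      using V(1) w_pos by (simp add: less_imp_neq[OF w_pos, symmetric])
    have 1: "(\<lambda>n. 1 / q (lvl n) / sqrt (w (lvl n))) \<longlonglongrightarrow> 0"
      by (rule filterlim_compose[OF inverse_q_sqrt_w[OF L] filterlim_lvl])
    have "filterlim (\<lambda>m. sqrt (w m)) at_top sequentially"
      by (rule filterlim_compose[OF sqrt_at_top lyapunovD(1)[OF L]])
    then have "filterlim (\<lambda>n. sqrt (w (lvl n))) at_top sequentially"
      by (rule filterlim_compose[OF _ filterlim_lvl])
    then have 2: "(\<lambda>n. 1 / sqrt (w (lvl n))) \<longlonglongrightarrow> 0"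
      by (rule tendsto_divide_0[OF tendsto_const filterlim_at_top_imp_at_infinity])
    have 3: "(\<lambda>n. (\<mu> (\<alpha> n) - \<mu> (lvl n)) / sqrt (w (lvl n))) \<longlonglongrightarrow> 0"
      using \<alpha> by (simp add: close_level_def)
    \<comment> \<open>Centring at \<open>theta\<close> instead of \<open>\<mu>\<close> costs
      \<open>1 / q - 1\<close> by \<open>\<mu>_eq_theta\<close>, which is negligible on the scale
      \<open>sqrt w\<close>.\<close>
    have "(\<lambda>n. ((\<mu> (\<alpha> n) - \<mu> (lvl n)) / sqrt (w (lvl n)) + 1 / q (lvl n) / sqrt (w (lvl n)) - 1 / sqrt (w (lvl n))) *
        sqrt (w (lvl n) / V (lvl n))) \<longlonglongrightarrow> (0 + 0 - 0) * sqrt 1"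
      by (intro tendsto_intros 1 2 3 wV)
    moreover have "((\<mu> (\<alpha> n) - \<mu> (lvl n)) / sqrt (w (lvl n)) + 1 / q (lvl n) / sqrt (w (lvl n)) - 1 / sqrt (w (lvl n))) *
        sqrt (w (lvl n) / V (lvl n)) = (\<mu> (\<alpha> n) - theta p \<delta> (lvl n)) / sqrt (V (lvl n))" for n
    proof -
      have "(\<mu> (\<alpha> n) - \<mu> (lvl n)) / sqrt (w (lvl n)) + 1 / q (lvl n) / sqrt (w (lvl n)) - 1 / sqrt (w (lvl n)) =
          (\<mu> (\<alpha> n) - theta p \<delta> (lvl n)) / sqrt (w (lvl n))"
        unfolding add_divide_distrib[symmetric] diff_divide_distrib[symmetric]
        by (simp add: \<mu>_eq_theta[of "lvl n"])
      then show ?thesis using w_pos[of "lvl n"] by (simp add: real_sqrt_divide)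
    qed
    ultimately show "(\<lambda>n. (\<mu> (\<alpha> n) - theta p \<delta> (lvl n)) / sqrt (V (lvl n))) \<longlonglongrightarrow> 0" by simp
  qed
  fix e :: real assume "0 < e"
  then obtain \<alpha> \<beta> where ab: "close_level \<alpha>" "close_level \<beta>"
    "\<forall>\<^sub>F n in sequentially. \<alpha> n \<le> \<beta> n \<and> real n * y (int (\<beta> n)) + exp (- (real n * y (int (\<alpha> n)))) \<le> e"
    using close by blast
  have "\<forall>\<^sub>F n in sequentially. 1 - e \<le> prob {\<omega> \<in> space M. \<alpha> n < runmax X n \<omega> \<and> runmax X n \<omega> \<le> \<beta> n}"
    using ab(3)
  proof eventually_elim
    case (elim n)
    then show ?case using prob_runmax_between[of "\<alpha> n" "\<beta> n" n] by linarith
  qed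
  with ab S show "\<exists>\<alpha> \<beta>.
      weak_conv_m (\<lambda>n. distr M borel (\<lambda>\<omega>. (real (S (\<alpha> n) \<omega>) - theta p \<delta> (lvl n)) / sqrt (V (lvl n)))) std_normal_distribution \<and>
      weak_conv_m (\<lambda>n. distr M borel (\<lambda>\<omega>. (real (S (\<beta> n) \<omega>) - theta p \<delta> (lvl n)) / sqrt (V (lvl n)))) std_normal_distribution \<and>
      (\<forall>\<^sub>F n in sequentially. 1 - e \<le> prob {\<omega> \<in> space M. \<alpha> n < runmax X n \<omega> \<and> runmax X n \<omega> \<le> \<beta> n})"
    by blast
qed

lemma close_level_bounded:
  assumes L: lyapunov and \<alpha>: "filterlim \<alpha> at_top sequentially"
    and B: "\<forall>\<^sub>F n in sequentially. \<bar>\<mu> (\<alpha> n) - \<mu> (lvl n)\<bar> \<le> B \<and> \<bar>w (\<alpha> n) - w (lvl n)\<bar> \<le> C"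
  shows "close_level \<alpha>"
  unfolding close_level_def
proof (intro conjI \<alpha>)
  have wl: "filterlim (\<lambda>n. w (lvl n)) at_top sequentially"
    by (rule filterlim_compose[OF lyapunovD(1)[OF L] filterlim_lvl])
  have "(\<lambda>n. (w (\<alpha> n) - w (lvl n)) / w (lvl n)) \<longlonglongrightarrow> 0"
  proof (rule Lim_null_comparison)
    show "\<forall>\<^sub>F n in sequentially. norm ((w (\<alpha> n) - w (lvl n)) / w (lvl n)) \<le> C / w (lvl n)"
      using B
    proof eventually_elim
      case (elim n)
      then have "\<bar>w (\<alpha> n) - w (lvl n)\<bar> / w (lvl n) \<le> C / w (lvl n)"
        using w_pos[of "lvl n"] by (intro divide_right_mono) auto
      then show ?case using w_pos[of "lvl n"] by (simp add: abs_divide)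
    qed
    show "(\<lambda>n. C / w (lvl n)) \<longlonglongrightarrow> 0"
      by (rule tendsto_divide_0[OF tendsto_const filterlim_at_top_imp_at_infinity[OF wl]])
  qed
  then have "(\<lambda>n. 1 + (w (\<alpha> n) - w (lvl n)) / w (lvl n)) \<longlonglongrightarrow> 1 + 0" by (intro tendsto_intros)
  moreover have "1 + (w (\<alpha> n) - w (lvl n)) / w (lvl n) = w (\<alpha> n) / w (lvl n)" for n
    using w_pos[of "lvl n"] by (simp add: field_simps)
  ultimately show "(\<lambda>n. w (\<alpha> n) / w (lvl n)) \<longlonglongrightarrow> 1" by simp
  have "filterlim (\<lambda>n. sqrt (w (lvl n))) at_top sequentially"
    by (rule filterlim_compose[OF sqrt_at_top wl])
  then have B0: "(\<lambda>n. B / sqrt (w (lvl n))) \<longlonglongrightarrow> 0"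
    by (rule tendsto_divide_0[OF tendsto_const filterlim_at_top_imp_at_infinity])
  show "(\<lambda>n. (\<mu> (\<alpha> n) - \<mu> (lvl n)) / sqrt (w (lvl n))) \<longlonglongrightarrow> 0"
  proof (rule Lim_null_comparison[OF _ B0])
    show "\<forall>\<^sub>F n in sequentially. norm ((\<mu> (\<alpha> n) - \<mu> (lvl n)) / sqrt (w (lvl n))) \<le> B / sqrt (w (lvl n))"
      using B
    proof eventually_elim
      case (elim n)
      then have "\<bar>\<mu> (\<alpha> n) - \<mu> (lvl n)\<bar> / sqrt (w (lvl n)) \<le> B / sqrt (w (lvl n))"
        using w_pos[of "lvl n"] by (intro divide_right_mono) auto
      then show ?case using w_pos[of "lvl n"] by (simp add: abs_divide)
    qed
  qed
qed

lemma close_level_compose: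
  assumes "filterlim \<psi> at_top sequentially" "(\<lambda>m. w (\<psi> m) / w m) \<longlonglongrightarrow> 1"
    "(\<lambda>m. (\<mu> (\<psi> m) - \<mu> m) / sqrt (w m)) \<longlonglongrightarrow> 0"
  shows "close_level (\<lambda>n. \<psi> (lvl n))"
  unfolding close_level_def
  using filterlim_compose[OF assms(1) filterlim_lvl] filterlim_compose[OF assms(2) filterlim_lvl]
    filterlim_compose[OF assms(3) filterlim_lvl] by simp

lemma CLT_bounded_hazard:
  assumes "limsup (\<lambda>k. ereal (r k)) < 1"
  shows "weak_conv_m (\<lambda>n. distr M borel (\<lambda>\<omega>. (real (nrec X \<delta> n \<omega>) - theta p \<delta> (lvl n)) /
    sqrt (\<Sum>k\<le>lvl n. zz p \<delta> k * r k / y (int k)))) std_normal_distribution"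
proof -
  obtain c where c: "0 < c" "\<And>k. c \<le> q k" using q_bounded_below[OF assms] by blast
  note L = lyapunov_if_bounded_below[OF c]
  \<comment> \<open>The level before \<open>mm p s\<close> still has tail at least
    \<open>1 / s\<close>, and one step loses at most a factor \<open>c\<close>.\<close>
  have bd: "c / s \<le> y (int (mm p s)) \<and> y (int (mm p s)) < 1 / s" if "0 < s" "1 \<le> mm p s" for s
  proof
    have "1 / s \<le> y (int (mm p s) - 1)" using mm_lower[of "mm p s - 1" s] that by (simp add: of_nat_diff)
    then have "c * (1 / s) \<le> c * y (int (mm p s) - 1)" using c by (intro mult_left_mono) auto
    then show "c / s \<le> y (int (mm p s))" using y_ge_mult[OF c, of "mm p s"] by simp
  qed (rule mm_upper[OF that(1)])
  show ?thesis
  proof (rule nrec_CLT[OF L _ sum_zz_over_w[OF c]])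
    show "0 \<le> (\<Sum>k\<le>m. zz p \<delta> k * r k / y (int k))" for m
      using zz_bounds(2)[OF c] r_bounds(1)
      by (intro sum_nonneg) (metis mult_nonneg_nonneg less_imp_le times_divide_eq_left)
    fix e :: real assume e: "0 < e"
    \<comment> \<open>Makes both \<open>1 / K\<close> and \<open>exp (- K)\<close> at most
      \<open>e / 2\<close>; these bound the probabilities of overshooting \<open>\<beta> n\<close>
      and of not passing \<open>\<alpha> n\<close>.\<close>
    define K where "K = max 1 (2 / e)"
    have K: "1 \<le> K" "2 / e \<le> K" by (auto simp: K_def)
    \<comment> \<open>The subtraction matters: minimality of \<open>mm\<close> bounds tails from
      below only strictly before it, giving \<open>K / n \<le> y (\<alpha> n)\<close>.\<close>
    define \<alpha> where "\<alpha> n = mm p (real n / K) - 1" for n :: nat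
    define \<beta> where "\<beta> n = mm p (real n * K)" for n :: nat
    have f1: "filterlim (\<lambda>n. mm p (real n / K)) at_top sequentially"
    proof (rule filterlim_compose[OF filterlim_mm])
      have "filterlim (\<lambda>n. 1 / K * real n) at_top sequentially"
        using K by (intro filterlim_tendsto_pos_mult_at_top[OF tendsto_const _ filterlim_real_sequentially]) auto
      then show "filterlim (\<lambda>n. real n / K) at_top sequentially" by simp
    qed
    have f\<alpha>: "filterlim \<alpha> at_top sequentially"
      unfolding \<alpha>_def by (rule filterlim_compose[OF filterlim_minus_const_nat_at_top f1])
    have f\<beta>: "filterlim \<beta> at_top sequentially"
    proof -
      have "filterlim (\<lambda>n. K * real n) at_top sequentially"
        using K by (intro filterlim_tendsto_pos_mult_at_top[OF tendsto_const _ filterlim_real_sequentially]) auto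
      then show ?thesis unfolding \<beta>_def by (intro filterlim_compose[OF filterlim_mm]) (simp add: mult.commute)
    qed
    \<comment> \<open>Bounds the logarithmic tail ratios from \<open>\<alpha> n\<close> to
      \<open>lvl n\<close> and from \<open>lvl n\<close> to \<open>\<beta> n\<close>: a factor
      \<open>K\<close> from the change of \<open>n\<close>, and at most two factors
      \<open>1 / c\<close> from rounding to integer levels.\<close>
    define R where "R = ln (K / c\<^sup>2)"
    have ev: "\<forall>\<^sub>F n in sequentially. 1 \<le> n \<and> 1 \<le> mm p (real n / K)"
      using f1 by (simp add: filterlim_at_top eventually_conj eventually_ge_at_top)
    have main: "\<alpha> n \<le> lvl n \<and> lvl n \<le> \<beta> n \<and>
        ln (y (int (\<alpha> n)) / y (int (lvl n))) \<le> R \<and> ln (y (int (lvl n)) / y (int (\<beta> n))) \<le> R \<and>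
        real n * y (int (\<beta> n)) + exp (- (real n * y (int (\<alpha> n)))) \<le> e"
      if n: "1 \<le> n" "1 \<le> mm p (real n / K)" for n
    proof -
      have n0: "0 < real n" "0 < real n / K" "0 < real n * K" using n K by auto
      have m1: "mm p (real n / K) \<le> lvl n"
        using n0 K by (intro mm_mono) (auto simp: divide_le_eq)
      have m2: "lvl n \<le> \<beta> n"
        unfolding \<beta>_def using n0 K by (intro mm_mono) auto
      have c1: "c \<le> 1" using c(2)[of 0] q_bounds(3)[of 0] by simp
      have yl: "c / real n \<le> y (int (lvl n))" "y (int (lvl n)) < 1 / real n"
        using bd[OF n0(1)] m1 n by auto
      have y\<beta>: "c / (real n * K) \<le> y (int (\<beta> n))" "y (int (\<beta> n)) < 1 / (real n * K)"
        using bd[OF n0(3)] m1 m2 n unfolding \<beta>_def by auto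
      have "\<alpha> n < mm p (real n / K)" using n by (simp add: \<alpha>_def)
      from mm_lower[OF this] have y\<alpha>: "K / real n \<le> y (int (\<alpha> n))" by simp
      have y\<alpha>2: "y (int (\<alpha> n)) \<le> K / (real n * c)"
      proof -
        have "c * y (int (\<alpha> n)) \<le> y (int (mm p (real n / K)))"
          using y_ge_mult[OF c, of "mm p (real n / K)"] n by (simp add: \<alpha>_def of_nat_diff)
        also have "\<dots> \<le> K / real n" using mm_upper[OF n0(2)] by simp
        finally show ?thesis using c n0 by (simp add: field_simps)
      qed
      have "y (int (\<alpha> n)) / y (int (lvl n)) \<le> (K / (real n * c)) / (c / real n)"
        using y\<alpha>2 yl(1) c n0 K by (intro frac_le) auto
      also have "\<dots> = K / c\<^sup>2" using n0 by (simp add: power2_eq_square)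
      finally have l1: "ln (y (int (\<alpha> n)) / y (int (lvl n))) \<le> R"
        unfolding R_def using y_pos by (intro ln_mono) auto
      have "y (int (lvl n)) / y (int (\<beta> n)) \<le> (1 / real n) / (c / (real n * K))"
        using y\<beta>(1) yl(2) c n0 K by (intro frac_le) auto
      also have "\<dots> = K / c" using n0 K by simp
      also have "\<dots> \<le> K / c\<^sup>2"
        using c c1 K power_decreasing[of 1 2 c] by (intro frac_le) auto
      finally have l2: "ln (y (int (lvl n)) / y (int (\<beta> n))) \<le> R"
        unfolding R_def using y_pos by (intro ln_mono) auto
      have Ki: "1 / K \<le> e / 2"
        using K e by (simp add: field_simps)
      have "real n * y (int (\<beta> n)) \<le> real n * (1 / (real n * K))"
        using y\<beta>(2) by (intro mult_left_mono) auto
      then have t1: "real n * y (int (\<beta> n)) \<le> e / 2" using Ki n0 by simp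
      have "K \<le> real n * y (int (\<alpha> n))" using y\<alpha> n0 by (simp add: pos_divide_le_eq mult.commute)
      then have "exp (- (real n * y (int (\<alpha> n)))) \<le> exp (- K)" by simp
      also have "\<dots> \<le> 1 / K"
        using K by (intro exp_minus_le_inverse) simp
      finally have t2: "exp (- (real n * y (int (\<alpha> n)))) \<le> e / 2" using Ki by simp
      have "\<alpha> n \<le> lvl n" using m1 by (simp add: \<alpha>_def)
      with m2 l1 l2 t1 t2 show ?thesis by simp
    qed
    have "close_level \<alpha>"
    proof (rule close_level_bounded[OF L f\<alpha>])
      show "\<forall>\<^sub>F n in sequentially. \<bar>\<mu> (\<alpha> n) - \<mu> (lvl n)\<bar> \<le> 1 / c * R \<and> \<bar>w (\<alpha> n) - w (lvl n)\<bar> \<le> 2 / c\<^sup>2 * R"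
        using ev
      proof eventually_elim
        case (elim n)
        note m = main[of n]
        have "1 / c * ln (y (int (\<alpha> n)) / y (int (lvl n))) \<le> 1 / c * R"
          "2 / c\<^sup>2 * ln (y (int (\<alpha> n)) / y (int (lvl n))) \<le> 2 / c\<^sup>2 * R"
          using m elim c by (auto intro!: mult_left_mono divide_right_mono)
        then show ?case
          using increments_le[OF c, of "\<alpha> n" "lvl n"] \<mu>_mono[of "\<alpha> n" "lvl n"] w_mono[of "\<alpha> n" "lvl n"] m elim
          by auto
      qed
    qed
    moreover have "close_level \<beta>"
    proof (rule close_level_bounded[OF L f\<beta>])
      show "\<forall>\<^sub>F n in sequentially. \<bar>\<mu> (\<beta> n) - \<mu> (lvl n)\<bar> \<le> 1 / c * R \<and> \<bar>w (\<beta> n) - w (lvl n)\<bar> \<le> 2 / c\<^sup>2 * R"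
        using ev
      proof eventually_elim
        case (elim n)
        note m = main[of n]
        have "1 / c * ln (y (int (lvl n)) / y (int (\<beta> n))) \<le> 1 / c * R"
          "2 / c\<^sup>2 * ln (y (int (lvl n)) / y (int (\<beta> n))) \<le> 2 / c\<^sup>2 * R"
          using m elim c by (auto intro!: mult_left_mono divide_right_mono)
        then show ?case
          using increments_le[OF c, of "lvl n" "\<beta> n"] \<mu>_mono[of "lvl n" "\<beta> n"] w_mono[of "lvl n" "\<beta> n"] m elim
          by auto
      qed
    qed
    moreover have "\<forall>\<^sub>F n in sequentially. \<alpha> n \<le> \<beta> n \<and>
        real n * y (int (\<beta> n)) + exp (- (real n * y (int (\<alpha> n)))) \<le> e"
      using ev
    proof eventually_elim
      case (elim n)
      then show ?case using main[of n] by auto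
    qed
    ultimately show "\<exists>\<alpha> \<beta>. close_level \<alpha> \<and> close_level \<beta> \<and>
      (\<forall>\<^sub>F n in sequentially. \<alpha> n \<le> \<beta> n \<and> real n * y (int (\<beta> n)) + exp (- (real n * y (int (\<alpha> n)))) \<le> e)"
      by blast
  qed
qed

text \<open>The definition of \<open>lvl n\<close> gives only \<open>n * y (lvl n) < 1\<close> and
  \<open>n * y (lvl n - 1) \<ge> 1\<close>, so the maximum need not concentrate on one level. One
  further step on either side multiplies or divides by a factor \<open>1 - r\<close> tending to 0,
  so the levels \<open>lvl n - 2\<close> and \<open>lvl n + 1\<close> enclose the maximum with high
  probability.\<close>

lemma CLT_hazard_tendsto_1:
  assumes r1: "r \<longlonglongrightarrow> 1" and rr: "(\<lambda>k. (1 - r (Suc k)) / (1 - r k)) \<longlonglongrightarrow> 1"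
  shows "weak_conv_m (\<lambda>n. distr M borel (\<lambda>\<omega>. (real (nrec X \<delta> n \<omega>) - theta p \<delta> (lvl n)) /
    sqrt (\<Sum>k\<le>lvl n. (1 - r k) powi (2 * \<delta>)))) std_normal_distribution"
proof -
  note L = lyapunov_if_tendsto_1[OF r1 rr]
  have wS: "(\<lambda>m. w m / w (Suc m)) \<longlonglongrightarrow> 1" by (rule w_Suc_ratio[OF L])
  have wS': "(\<lambda>m. w (Suc m) / w m) \<longlonglongrightarrow> 1" using tendsto_inverse[OF wS] by simp
  have \<mu>S: "(\<lambda>m. (\<mu> (Suc m) - \<mu> m) / sqrt (w (Suc m))) \<longlonglongrightarrow> 0" by (rule \<mu>_Suc_increment[OF L])
  have wn: "w m \<noteq> 0" for m using w_pos[of m] by simp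
  have up: "close_level (\<lambda>n. Suc (lvl n))"
  proof (rule close_level_compose[OF filterlim_Suc wS'])
    have "(\<lambda>m. (\<mu> (Suc m) - \<mu> m) / sqrt (w (Suc m)) * sqrt (w (Suc m) / w m)) \<longlonglongrightarrow> 0 * sqrt 1"
      by (intro tendsto_intros \<mu>S wS')
    then show "(\<lambda>m. (\<mu> (Suc m) - \<mu> m) / sqrt (w m)) \<longlonglongrightarrow> 0"
      by (simp add: real_sqrt_divide wn)
  qed
  have down: "close_level (\<lambda>n. lvl n - 2)"
  proof (rule close_level_compose[OF filterlim_minus_const_nat_at_top])
    have "(\<lambda>m. w m / w (Suc m) * (w (Suc m) / w (Suc (Suc m)))) \<longlonglongrightarrow> 1 * 1"
      by (intro tendsto_mult wS LIMSEQ_Suc[OF wS])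
    then have "(\<lambda>m. w (m + 2 - 2) / w (m + 2)) \<longlonglongrightarrow> 1" by (simp add: wn)
    then show "(\<lambda>m. w (m - 2) / w m) \<longlonglongrightarrow> 1" by (rule LIMSEQ_offset)
    have "(\<lambda>m. - ((\<mu> (Suc (Suc m)) - \<mu> (Suc m)) / sqrt (w (Suc (Suc m))) +
        (\<mu> (Suc m) - \<mu> m) / sqrt (w (Suc m)) * sqrt (w (Suc m) / w (Suc (Suc m))))) \<longlonglongrightarrow> - (0 + 0 * sqrt 1)"
      by (intro tendsto_intros \<mu>S LIMSEQ_Suc[OF \<mu>S] LIMSEQ_Suc[OF wS])
    moreover have "- ((\<mu> (Suc (Suc m)) - \<mu> (Suc m)) / sqrt (w (Suc (Suc m))) +
        (\<mu> (Suc m) - \<mu> m) / sqrt (w (Suc m)) * sqrt (w (Suc m) / w (Suc (Suc m)))) =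
        (\<mu> (m + 2 - 2) - \<mu> (m + 2)) / sqrt (w (m + 2))" for m
    proof -
      have "(\<mu> (Suc m) - \<mu> m) / sqrt (w (Suc m)) * sqrt (w (Suc m) / w (Suc (Suc m))) =
          (\<mu> (Suc m) - \<mu> m) / sqrt (w (Suc (Suc m)))"
        by (simp add: real_sqrt_divide wn)
      then show ?thesis by (simp add: diff_divide_distrib)
    qed
    ultimately have "(\<lambda>m. (\<mu> (m + 2 - 2) - \<mu> (m + 2)) / sqrt (w (m + 2))) \<longlonglongrightarrow> 0" by simp
    then show "(\<lambda>m. (\<mu> (m - 2) - \<mu> m) / sqrt (w m)) \<longlonglongrightarrow> 0" by (rule LIMSEQ_offset)
  qed
  show ?thesis
  proof (rule nrec_CLT[OF L _ sum_powi_over_w[OF r1 rr]])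
    show "0 \<le> (\<Sum>k\<le>m. (1 - r k) powi (2 * \<delta>))" for m
      using powi_ge_1[OF r1 rr] by (intro sum_nonneg) (meson order_trans zero_le_one)
    fix e :: real assume e: "0 < e"
    have "(\<lambda>k. 1 - r k) \<longlonglongrightarrow> 1 - 1" by (intro tendsto_intros r1)
    then have "\<forall>\<^sub>F k in sequentially. 1 - r k < e / 2" using e by (intro order_tendstoD(2)) auto
    then obtain N where N: "\<And>k. k \<ge> N \<Longrightarrow> 1 - r k < e / 2" by (auto simp: eventually_sequentially)
    have "\<forall>\<^sub>F n in sequentially. N + 2 \<le> lvl n"
      using filterlim_lvl by (simp add: filterlim_at_top)
    then have "\<forall>\<^sub>F n in sequentially. N + 2 \<le> lvl n \<and> 1 \<le> n"
      by (intro eventually_conj eventually_ge_at_top)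
    then have "\<forall>\<^sub>F n in sequentially. lvl n - 2 \<le> Suc (lvl n) \<and>
        real n * y (int (Suc (lvl n))) + exp (- (real n * y (int (lvl n - 2)))) \<le> e"
    proof eventually_elim
      case (elim n)
      have n: "0 < real n" using elim by simp
      obtain k where k: "lvl n = Suc (Suc k)" "N \<le> k"
        using elim by (intro that[of "lvl n - 2"]) auto
      have "real n * y (int (Suc (lvl n))) \<le> 1 / y (int (lvl n)) * y (int (Suc (lvl n)))"
        using mm_upper[OF n] y_pos[of "int (lvl n)"] y_pos[of "int (Suc (lvl n))"] n
        by (intro mult_right_mono) (auto simp: field_simps less_imp_le)
      also have "\<dots> = 1 - r (Suc (lvl n))" unfolding one_minus_r by simp
      also have "\<dots> < e / 2" using elim by (intro N) simp
      finally have 1: "real n * y (int (Suc (lvl n))) < e / 2" .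
      have ly: "1 / real n \<le> y (int (Suc k))" using k by (intro mm_lower) simp
      have "1 / (1 - r (Suc k)) = y (int k) / y (int (Suc k))" unfolding one_minus_r by simp
      also have "\<dots> = y (int k) * (1 / y (int (Suc k)))" by simp
      also have "\<dots> \<le> y (int k) * real n"
        using ly n y_pos[of "int k"] y_pos[of "int (Suc k)"] by (intro mult_left_mono) (auto simp: field_simps)
      finally have x: "1 / (1 - r (Suc k)) \<le> real n * y (int k)" by (simp add: mult.commute)
      have g: "0 < 1 - r (Suc k)" using r_bounds(2)[of "Suc k"] by simp
      have "exp (- (real n * y (int k))) \<le> exp (- (1 / (1 - r (Suc k))))" using x by simp
      also have "\<dots> \<le> 1 - r (Suc k)"
        using exp_minus_le_inverse[of "1 / (1 - r (Suc k))"] g by simp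
      also have "\<dots> < e / 2" using k by (intro N) simp
      finally have "exp (- (real n * y (int (lvl n - 2)))) < e / 2" using k by simp
      with 1 show ?case by simp
    qed
    with up down show "\<exists>\<alpha> \<beta>. close_level \<alpha> \<and> close_level \<beta> \<and>
      (\<forall>\<^sub>F n in sequentially. \<alpha> n \<le> \<beta> n \<and> real n * y (int (\<beta> n)) + exp (- (real n * y (int (\<alpha> n)))) \<le> e)"
      by blast
  qed
qed

end

theorem theorem3p1:
  fixes M :: "'a measure" and X :: "nat \<Rightarrow> 'a \<Rightarrow> nat" and p :: "nat \<Rightarrow> real" and \<delta> :: int
  assumes "prob_space M"
    and "\<And>i. i \<ge> 1 \<Longrightarrow> X i \<in> measurable M (count_space UNIV)"
    and "prob_space.indep_vars M (\<lambda>_. count_space UNIV) X {1..}"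
    and "\<And>i k. i \<ge> 1 \<Longrightarrow> measure M {\<omega> \<in> space M. X i \<omega> = k} = p k"
    and "\<And>k. p k > 0"
    and "\<delta> < 0"
  shows
    "(limsup (\<lambda>k. ereal (rr p k)) < 1 \<longrightarrow>
       weak_conv_m
         (\<lambda>n. distr M borel (\<lambda>\<omega>. (real (nrec X \<delta> n \<omega>) - theta p \<delta> (mm p (real n)))
               / sqrt (\<Sum>k\<le>mm p (real n). zz p \<delta> k * rr p k / yZ p (int k))))
         std_normal_distribution)
     \<and>
     ((rr p \<longlonglongrightarrow> 1) \<and> ((\<lambda>k. (1 - rr p (Suc k)) / (1 - rr p k)) \<longlonglongrightarrow> 1) \<longrightarrow>
       weak_conv_m
         (\<lambda>n. distr M borel (\<lambda>\<omega>. (real (nrec X \<delta> n \<omega>) - theta p \<delta> (mm p (real n)))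
               / sqrt (\<Sum>k\<le>mm p (real n). (1 - rr p k) powi (2 * \<delta>))))
         std_normal_distribution)"
proof -
  interpret prob_space M by fact
  \<comment> \<open>The normalisation required by \<open>tail_weights\<close> follows from countable
    additivity over the values of \<open>X 1\<close>.\<close>
  have "p sums measure M (\<Union>k. {\<omega> \<in> space M. X 1 \<omega> = k})"
  proof -
    have "X 1 -` {k} \<inter> space M \<in> sets M" for k
      by (rule measurable_sets[OF assms(2)]) simp_all
    moreover have "X 1 -` {k} \<inter> space M = {\<omega> \<in> space M. X 1 \<omega> = k}" for k by auto
    ultimately have "(\<lambda>k. measure M {\<omega> \<in> space M. X 1 \<omega> = k}) sums measure M (\<Union>k. {\<omega> \<in> space M. X 1 \<omega> = k})"
      by (intro finite_measure_UNION) (auto simp: disjoint_family_on_def)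
    then show ?thesis using assms(4)[of 1] by simp
  qed
  moreover have "(\<Union>k. {\<omega> \<in> space M. X 1 \<omega> = k}) = space M" by auto
  ultimately have sums: "p sums 1" by (simp add: prob_space)
  interpret record_model M p \<delta> X
    by unfold_locales (fact assms sums)+
  show ?thesis
    using CLT_bounded_hazard CLT_hazard_tendsto_1 by blast
qed

end
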